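(* Let $B$ be an even, unimodular, indefinite integral lattice, and let $A = B(2)\oplus U$. For an integer $n$, consider the set of primitive vectors $\omega\in A$ with $\langle \omega,\omega\rangle = 2n$. The number of orbits of this set under the action of the orthogonal group $O(A)$ is exactly $1$ if $n$ is odd, and exactly $2$ if $n$ is even.
   Context: A lattice is a free $\mathbb{Z}$-module of finite rank with a nondegenerate symmetric integral bilinear form $\langle\cdot,\cdot\rangle$. $U$ denotes the hyperbolic plane: rank $2$ with basis $u,v$, $\langle u,u\rangle=\langle v,v\rangle=0$, $\langle u,v\rangle=1$. For a lattice $L$ and nonzero integer $m$, $L(m)$ is the same $\mathbb{Z}$-module with form multiplied by $m$. A nonzero $\omega\in L$ is primitive if $\frac{1}{k}\omega\notin L$ for every integer $k\neq\pm1$. $O(L)$ is the group of isometries of $L$ onto itself. *)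

theory Defs
  imports "HOL-Analysis.Analysis"
begin

text \<open>A lattice of rank CARD('m) is modelled as the Z-module int^'m (standard basis)
  together with its Gram matrix M (symmetric integer matrix).\<close>

definition bil :: "int^'m^'m \<Rightarrow> int^'m \<Rightarrow> int^'m \<Rightarrow> int" where
  "bil M x y = (\<Sum>i\<in>UNIV. \<Sum>j\<in>UNIV. x$i * M$i$j * y$j)"

definition symmetric_gram :: "int^'m^'m \<Rightarrow> bool" where
  "symmetric_gram M \<longleftrightarrow> (\<forall>i j. M$i$j = M$j$i)"

definition unimodular :: "int^'m^'m \<Rightarrow> bool" where
  "unimodular M \<longleftrightarrow> det M = 1 \<or> det M = -1"

definition even_lattice :: "int^'m^'m \<Rightarrow> bool" where
  "even_lattice M \<longleftrightarrow> (\<forall>x. even (bil M x x))"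

definition indefinite :: "int^'m^'m \<Rightarrow> bool" where
  "indefinite M \<longleftrightarrow> (\<exists>x. bil M x x > 0) \<and> (\<exists>y. bil M y y < 0)"

definition primitive :: "int^'m \<Rightarrow> bool" where
  "primitive w \<longleftrightarrow> w \<noteq> 0 \<and> (\<forall>(k::int) v. w = k *s v \<longrightarrow> k = 1 \<or> k = -1)"

definition orth_group :: "int^'m^'m \<Rightarrow> (int^'m \<Rightarrow> int^'m) set" where
  "orth_group M = {f. bij f \<and> (\<forall>x y. f (x + y) = f x + f y) \<and> (\<forall>(k::int) x. f (k *s x) = k *s f x)
                       \<and> (\<forall>x y. bil M (f x) (f y) = bil M x y)}"

text \<open>Gram matrix of B(2) \<oplus> U, with index set 'n + bool (Inr False = u, Inr True = v).\<close>
definition twice_plus_U :: "int^'n^'n \<Rightarrow> int^('n + bool)^('n + bool)" where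
  "twice_plus_U G = (\<chi> i j. (case (i, j) of
       (Inl a, Inl b) \<Rightarrow> 2 * G$a$b
     | (Inr p, Inr q) \<Rightarrow> (if p \<noteq> q then 1 else 0)
     | _ \<Rightarrow> 0))"

definition orbit_rel :: "int^'m^'m \<Rightarrow> ((int^'m) \<times> (int^'m)) set" where
  "orbit_rel M = {(x, y). \<exists>f\<in>orth_group M. f x = y}"

end

theory Submission
  imports Defs "HOL-Combinatorics.List_Permutation" "HOL-Computational_Algebra.Primes"
begin

text \<open>
  The indefinite unimodular lattice \<open>B\<close> is isotropic. Over the rationals a form is Witt equivalent
  to one with entries plus or minus one as soon as it contains a self-dual lattice at every prime:
  at the largest prime \<open>p\<close> dividing a diagonal entry, the self-dual lattice forces the entries
  \<open>pu\<close> to give an isotropic form \<open>\<Sum>uc\<^sup>2\<close> modulo \<open>p\<close>, and each such zero removes entries divisible by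
  \<open>p\<close> at the cost of entries with smaller primes (the computation of the Witt group of the integers).
  Hence \<open>B\<close> is Witt equivalent to a definite form, so an indefinite \<open>B\<close> has a nonzero isotropic
  vector and splits off a hyperbolic plane spanned by \<open>e\<close>, \<open>f\<close>.

  Write vectors of \<open>B(2) + U\<close> as \<open>(b, x, y)\<close>. The Eichler transvections
  \<open>(b, x, y) \<mapsto> (b + xa, x, y - 2\<langle>a,b\<rangle> - x\<langle>a,a\<rangle>)\<close> allow a Euclidean descent on \<open>|x|\<close> when \<open>x\<close> is odd,
  ending in \<open>(0, 1, n)\<close>, and on \<open>|\<langle>e,b\<rangle>|\<close> when \<open>x\<close> and \<open>y\<close> are even, ending in
  \<open>(f + (n/2)e, 0, 0)\<close>. The second form occurs only for even \<open>n\<close>, and it differs from the first in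
  that all its pairings are even.
\<close>

section \<open>Symmetric bilinear forms on rational sequences\<close>

text \<open>Diagonal forms of every length act on the one space of all rational sequences, where the
  coordinates beyond the length form a radical; hyperbolic planes can then be added or removed
  without changing the space. What is transported along the reduction is not an isometry class but
  two properties: being definite up to a totally isotropic subspace, and having a self-dual lattice
  at each prime. The difficulty in eliminating a prime p is that every correction entry must have
  only primes below p, otherwise the induction does not end. Hence residues are chosen of absolute
  value below p, and multipliers |l| < p. In the orbit part the obstacle is the factor 2 of B(2):
  along an isotropic vector a transvection changes x only by even multiples of a pairing t, so
  division is modulo 2t and makes progress only if 2|t| < |x|. Centered remainders give the weak
  inequality, parity makes it strict. If x and y are even, their halves change by the pairing itself
  and the factor 2 moves to the change of b; this exchanges the roles of x and <e,b>.\<close>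

definition lincomb :: "(nat \<Rightarrow> rat) \<Rightarrow> rat \<Rightarrow> (nat \<Rightarrow> rat) \<Rightarrow> nat \<Rightarrow> rat" where
  "lincomb x c y = (\<lambda>i. x i + c * y i)"

definition sym_bilinear :: "((nat \<Rightarrow> rat) \<Rightarrow> (nat \<Rightarrow> rat) \<Rightarrow> rat) \<Rightarrow> bool" where
  "sym_bilinear \<beta> \<longleftrightarrow> (\<forall>x y. \<beta> x y = \<beta> y x) \<and>
     (\<forall>x c y z. \<beta> (lincomb x c y) z = \<beta> x z + c * \<beta> y z)"

lemma sym_bilinear_sym: "sym_bilinear \<beta> \<Longrightarrow> \<beta> x y = \<beta> y x"
  by (simp add: sym_bilinear_def)

lemma sym_bilinear_left: "sym_bilinear \<beta> \<Longrightarrow> \<beta> (lincomb x c y) z = \<beta> x z + c * \<beta> y z"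
  unfolding sym_bilinear_def by blast

lemma sym_bilinear_right: "sym_bilinear \<beta> \<Longrightarrow> \<beta> z (lincomb x c y) = \<beta> z x + c * \<beta> z y"
  using sym_bilinear_left[of \<beta> x c y z] sym_bilinear_sym[of \<beta>] by metis

text \<open>Witt equivalence of \<open>\<beta>\<close> to a form of sign \<open>s\<close>, phrased without dimensions: the quotient of
  \<open>L\<close>-perp by a totally isotropic \<open>L\<close> is definite. Forms may have a radical; it is contained in \<open>L\<close>.\<close>

definition witt_definite :: "rat \<Rightarrow> ((nat \<Rightarrow> rat) \<Rightarrow> (nat \<Rightarrow> rat) \<Rightarrow> rat) \<Rightarrow> bool" where
  "witt_definite s \<beta> \<longleftrightarrow> (\<exists>L. L \<noteq> {} \<and> (\<forall>x\<in>L. \<forall>y\<in>L. \<forall>c. lincomb x c y \<in> L) \<and>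
     (\<forall>x\<in>L. \<forall>y\<in>L. \<beta> x y = 0) \<and>
     (\<forall>v. (\<forall>x\<in>L. \<beta> v x = 0) \<longrightarrow> v \<in> L \<or> s * \<beta> v v > 0))"

definition local_ring :: "int \<Rightarrow> rat set" where
  "local_ring p = {r. \<exists>a b. \<not> p dvd b \<and> r = of_int a / of_int b}"

text \<open>Closure under combinations with coefficients in the local ring follows from
  self-duality. The second condition makes L a full lattice: an isotropic line in a hyperbolic plane
  also equals its own dual.\<close>

definition self_dual_lattice ::
    "int \<Rightarrow> ((nat \<Rightarrow> rat) \<Rightarrow> (nat \<Rightarrow> rat) \<Rightarrow> rat) \<Rightarrow> (nat \<Rightarrow> rat) set \<Rightarrow> bool" where
  "self_dual_lattice p \<beta> L \<longleftrightarrow>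
     (\<forall>v. v \<in> L \<longleftrightarrow> (\<forall>x\<in>L. \<beta> v x \<in> local_ring p)) \<and>
     (\<forall>v. \<exists>k::nat. (\<lambda>i. of_int p ^ k * v i) \<in> L)"

definition locally_unimodular :: "int \<Rightarrow> ((nat \<Rightarrow> rat) \<Rightarrow> (nat \<Rightarrow> rat) \<Rightarrow> rat) \<Rightarrow> bool" where
  "locally_unimodular p \<beta> \<longleftrightarrow> (\<exists>L. self_dual_lattice p \<beta> L)"

subsection \<open>The localization of the integers at a prime\<close>

context
  fixes p :: int
  assumes p: "prime p"
begin

lemma local_ring_of_int [simp]: "of_int a \<in> local_ring p"
  unfolding local_ring_def using p not_prime_unit by (intro CollectI exI[of _ a] exI[of _ 1]) auto

lemma local_ring_0 [simp]: "0 \<in> local_ring p" and local_ring_1 [simp]: "1 \<in> local_ring p"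
  using local_ring_of_int[of 0] local_ring_of_int[of 1] by simp_all

lemma local_ring_add: 
  assumes "x \<in> local_ring p" "y \<in> local_ring p" shows "x + y \<in> local_ring p"
proof -
  obtain a b c d where h: "\<not> p dvd b" "x = of_int a / of_int b" "\<not> p dvd d" "y = of_int c / of_int d"
    using assms unfolding local_ring_def by blast
  then have "b \<noteq> 0" "d \<noteq> 0" by auto
  then have "x + y = of_int (a * d + c * b) / of_int (b * d)"
    using h by (simp add: field_simps)
  moreover have "\<not> p dvd b * d" using h p by (simp add: prime_dvd_mult_iff)
  ultimately show ?thesis unfolding local_ring_def by blast
qed

lemma local_ring_mult: 
  assumes "x \<in> local_ring p" "y \<in> local_ring p" shows "x * y \<in> local_ring p"
proof -
  obtain a b c d where h: "\<not> p dvd b" "x = of_int a / of_int b" "\<not> p dvd d" "y = of_int c / of_int d"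
    using assms unfolding local_ring_def by blast
  have "x * y = of_int (a * c) / of_int (b * d)"
    using h by (simp add: field_simps)
  moreover have "\<not> p dvd b * d" using h p by (simp add: prime_dvd_mult_iff)
  ultimately show ?thesis unfolding local_ring_def by blast
qed

lemma local_ring_uminus: "x \<in> local_ring p \<Longrightarrow> - x \<in> local_ring p"
  using local_ring_mult[OF local_ring_of_int[of "-1"], of x] by simp

lemma local_ring_diff: "x \<in> local_ring p \<Longrightarrow> y \<in> local_ring p \<Longrightarrow> x - y \<in> local_ring p"
  using local_ring_add[of x "- y"] local_ring_uminus by simp

lemma local_ring_power: "x \<in> local_ring p \<Longrightarrow> x ^ k \<in> local_ring p"
  by (induction k) (auto intro: local_ring_mult)

lemma local_ring_sum: "(\<And>i. i \<in> A \<Longrightarrow> f i \<in> local_ring p) \<Longrightarrow> sum f A \<in> local_ring p"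
  by (induction A rule: infinite_finite_induct) (auto intro: local_ring_add)

lemma local_ring_of_int_divide_iff:
  "of_int a / of_int p \<in> local_ring p \<longleftrightarrow> p dvd a"
proof
  have p0: "p \<noteq> 0" using p by auto
  assume "of_int a / of_int p \<in> local_ring p"
  then obtain c d where h: "\<not> p dvd d" "of_int a / of_int p = (of_int c / of_int d :: rat)"
    unfolding local_ring_def by blast
  then have "d \<noteq> 0" by auto
  then have "of_int (a * d) = (of_int (c * p) :: rat)" using h(2) p0 by (simp add: field_simps)
  then have "a * d = c * p" using of_int_eq_iff by blast
  then have "p dvd a * d" by simp
  then show "p dvd a" using h(1) p by (simp add: prime_dvd_mult_iff)
next
  assume "p dvd a" then show "of_int a / of_int p \<in> local_ring p" using p by auto
qed

lemma local_ring_unit: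
  assumes "x \<in> local_ring p" "x / of_int p \<notin> local_ring p"
  shows "1 / x \<in> local_ring p"
proof -
  obtain a b where h: "\<not> p dvd b" "x = of_int a / of_int b"
    using assms unfolding local_ring_def by blast
  have "\<not> p dvd a"
  proof
    assume "p dvd a"
    then obtain c where "a = p * c" by blast
    then have "x / of_int p = of_int c / of_int b" using h p by auto
    then show False using assms(2) h(1) unfolding local_ring_def by blast
  qed
  moreover have "1 / x = of_int b / of_int a" using h by simp
  ultimately show ?thesis unfolding local_ring_def by blast
qed

text \<open>In a fraction in lowest terms p cannot divide both numerator and denominator, so the
  local ring is a valuation ring.\<close>

lemma local_ring_inverse:
  assumes "x \<notin> local_ring p" shows "1 / x \<in> local_ring p"
proof -
  obtain a b where ab: "x = of_int a / of_int b" "coprime a b"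
    by (metis Fract_of_int_quotient Rat_cases)
  then have "p dvd b" using assms unfolding local_ring_def by blast
  then have "\<not> p dvd a" using ab(2) p not_prime_unit by (metis coprime_common_divisor)
  moreover have "1 / x = of_int b / of_int a" using ab by simp
  ultimately show ?thesis unfolding local_ring_def by blast
qed

lemma ex_power_mult_local_ring: "\<exists>k. of_int p ^ k * x \<in> local_ring p"
proof -
  obtain a b where ab: "x = of_int a / of_int b" "b > 0"
    by (metis Fract_of_int_quotient Rat_cases)
  obtain c where c: "b = p ^ multiplicity p b * c" "\<not> p dvd c"
    using multiplicity_decompose'[of b p] ab p not_prime_unit by (metis less_irrefl)
  have "p ^ multiplicity p b \<noteq> 0" using p by auto
  have e: "(of_int b :: rat) = of_int p ^ multiplicity p b * of_int c"
    using arg_cong[OF c(1), of "of_int :: int \<Rightarrow> rat"] by (simp del: of_int_eq_iff)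
  have "of_int p ^ multiplicity p b * x = of_int a / of_int c"
    unfolding ab(1) e using p c by (auto simp: field_simps)
  then show ?thesis using c(2) unfolding local_ring_def by blast
qed

lemma ex_divide_power_notin_local_ring:
  assumes "x \<noteq> 0" shows "\<exists>k. x / of_int p ^ k \<notin> local_ring p"
proof -
  obtain k where k: "of_int p ^ k * (1 / x) \<in> local_ring p" using ex_power_mult_local_ring by blast
  have "x / of_int p ^ Suc k \<notin> local_ring p"
  proof
    assume "x / of_int p ^ Suc k \<in> local_ring p"
    from local_ring_mult[OF this k] have "of_int 1 / of_int p \<in> local_ring p"
      using p assms by (simp add: field_simps)
    then have "p dvd 1" by (simp only: local_ring_of_int_divide_iff)
    then show False using p not_prime_unit by blast
  qed
  then show ?thesis by blast
qed

text \<open>The power p^k bounds the denominators in I, so the valuation at p attains a minimum on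
  I; \<open>r0\<close> is an element of smallest valuation.\<close>

lemma bounded_fractional_ideal_principal:
  assumes "r \<in> I" "r \<noteq> 0" "\<forall>r\<in>I. of_int p ^ k * r \<in> local_ring p"
  shows "\<exists>r0\<in>I. r0 \<noteq> 0 \<and> (\<forall>r\<in>I. r / r0 \<in> local_ring p)"
proof -
  have p0: "(of_int p :: rat) \<noteq> 0" using p by auto
  \<comment> \<open>\<open>P j\<close> says that some element of p^k I has valuation at most j,
    whence the exponent \<open>Suc j\<close>; the least such j is the minimal valuation.\<close>
  define P where "P j \<longleftrightarrow> (\<exists>r\<in>I. of_int p ^ k * r / of_int p ^ Suc j \<notin> local_ring p)" for j
  obtain m where m: "of_int p ^ k * r / of_int p ^ m \<notin> local_ring p"
    using ex_divide_power_notin_local_ring[of "of_int p ^ k * r"] assms p0 by auto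
  have "m \<noteq> 0" using m assms by (auto intro: ccontr)
  then have "P (m - 1)" unfolding P_def using m assms(1) by auto
  define j where "j = (LEAST j. P j)"
  have "P j" unfolding j_def using \<open>P (m - 1)\<close> by (rule LeastI)
  then obtain r0 where r0: "r0 \<in> I" "of_int p ^ k * r0 / of_int p ^ Suc j \<notin> local_ring p"
    unfolding P_def by blast
  have all: "of_int p ^ k * r / of_int p ^ j \<in> local_ring p" if "r \<in> I" for r
  proof (cases j)
    case 0 then show ?thesis using assms that by simp
  next
    case (Suc i)
    then have "\<not> P i" using not_less_Least[of i P] j_def by auto
    then show ?thesis using that Suc unfolding P_def by blast
  qed
  have u: "1 / (of_int p ^ k * r0 / of_int p ^ j) \<in> local_ring p"
    using all[OF r0(1)] r0(2) by (intro local_ring_unit) (simp_all add: mult.commute)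
  have "r0 \<noteq> 0" using r0(2) by auto
  moreover have "r / r0 \<in> local_ring p" if "r \<in> I" for r
    using local_ring_mult[OF all[OF that] u] p0 by simp
  ultimately show ?thesis using r0(1) by blast
qed

end

subsection \<open>Invariance under isometries\<close>

text \<open>Subspaces and lattices are carried forward by image and back by preimage; surjectivity
  turns every test vector into a value of \<open>f\<close>.\<close>

lemma isometry_transfer:
  assumes lin: "\<And>x c y. f (lincomb x c y) = lincomb (f x) c (f y)" and surj: "surj f"
    and iso: "\<And>x y. \<beta>' (f x) (f y) = \<beta> x y"
  shows witt_definite_isometry: "witt_definite s \<beta> \<longleftrightarrow> witt_definite s \<beta>'"
    and locally_unimodular_isometry: "locally_unimodular p \<beta> \<longleftrightarrow> locally_unimodular p \<beta>'"
proof -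
  \<comment> \<open>Linearity is given for \<open>lincomb\<close> only, so c v is written as v + (c
    - 1) v.\<close>
  have sc: "f (\<lambda>i. c * v i) = (\<lambda>i. c * f v i)" for c v
  proof -
    have "(\<lambda>i. c * v i) = lincomb v (c - 1) v" by (auto simp: lincomb_def algebra_simps)
    then show ?thesis by (simp only: lin) (auto simp: lincomb_def algebra_simps)
  qed
  show "witt_definite s \<beta> \<longleftrightarrow> witt_definite s \<beta>'"
  proof
    assume "witt_definite s \<beta>"
    then obtain L where L: "L \<noteq> {}" "\<forall>x\<in>L. \<forall>y\<in>L. \<forall>c. lincomb x c y \<in> L" "\<forall>x\<in>L. \<forall>y\<in>L. \<beta> x y = 0"
      "\<And>v. \<forall>x\<in>L. \<beta> v x = 0 \<Longrightarrow> v \<in> L \<or> s * \<beta> v v > 0" unfolding witt_definite_def by blast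
    have "v' \<in> f ` L \<or> s * \<beta>' v' v' > 0" if "\<forall>x\<in>f ` L. \<beta>' v' x = 0" for v'
    proof -
      obtain v where v: "v' = f v" using surj by (metis surjD)
      show ?thesis using L(4)[of v] that iso unfolding v by auto
    qed
    then show "witt_definite s \<beta>'" unfolding witt_definite_def using L(1-3)
      by (intro exI[of _ "f ` L"]) (auto simp: iso lin[symmetric])
  next
    assume "witt_definite s \<beta>'"
    then obtain L where L: "L \<noteq> {}" "\<forall>x\<in>L. \<forall>y\<in>L. \<forall>c. lincomb x c y \<in> L" "\<forall>x\<in>L. \<forall>y\<in>L. \<beta>' x y = 0"
      "\<And>v. \<forall>x\<in>L. \<beta>' v x = 0 \<Longrightarrow> v \<in> L \<or> s * \<beta>' v v > 0" unfolding witt_definite_def by blast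
    have "v \<in> f -` L \<or> s * \<beta> v v > 0" if "\<forall>x\<in>f -` L. \<beta> v x = 0" for v
    proof -
      have "\<beta>' (f v) x = 0" if "x \<in> L" for x
        using surjD[OF surj, of x] that \<open>\<forall>x\<in>f -` L. \<beta> v x = 0\<close> iso by auto
      then show ?thesis using L(4)[of "f v"] iso by auto
    qed
    moreover have "f -` L \<noteq> {}" using L(1) surj by (metis surjD vimageI2 ex_in_conv)
    ultimately show "witt_definite s \<beta>" unfolding witt_definite_def using L(2,3)
      by (intro exI[of _ "f -` L"]) (auto simp: iso[symmetric] lin)
  qed
  show "locally_unimodular p \<beta> \<longleftrightarrow> locally_unimodular p \<beta>'"
  proof
    assume "locally_unimodular p \<beta>"
    then obtain L where L: "\<And>v. v \<in> L \<longleftrightarrow> (\<forall>x\<in>L. \<beta> v x \<in> local_ring p)"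
      "\<And>v. \<exists>k::nat. (\<lambda>i. of_int p ^ k * v i) \<in> L"
      unfolding locally_unimodular_def self_dual_lattice_def by blast
    have "v' \<in> f ` L \<longleftrightarrow> (\<forall>x\<in>f ` L. \<beta>' v' x \<in> local_ring p)" for v'
    proof
      assume "v' \<in> f ` L" then show "\<forall>x\<in>f ` L. \<beta>' v' x \<in> local_ring p" using iso L(1) by (metis imageE)
    next
      assume a: "\<forall>x\<in>f ` L. \<beta>' v' x \<in> local_ring p"
      obtain v where v: "v' = f v" using surj by (metis surjD)
      have "\<forall>x\<in>L. \<beta> v x \<in> local_ring p" using a iso unfolding v by auto
      then have "v \<in> L" using L(1) by blast
      then show "v' \<in> f ` L" unfolding v by blast
    qed
    moreover have "\<exists>k::nat. (\<lambda>i. of_int p ^ k * v' i) \<in> f ` L" for v'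
    proof -
      obtain v where v: "v' = f v" using surj by (metis surjD)
      show ?thesis using L(2)[of v] unfolding v sc[symmetric] by blast
    qed
    ultimately show "locally_unimodular p \<beta>'"
      unfolding locally_unimodular_def self_dual_lattice_def by blast
  next
    assume "locally_unimodular p \<beta>'"
    then obtain L where L: "\<And>v. v \<in> L \<longleftrightarrow> (\<forall>x\<in>L. \<beta>' v x \<in> local_ring p)"
      "\<And>v. \<exists>k::nat. (\<lambda>i. of_int p ^ k * v i) \<in> L"
      unfolding locally_unimodular_def self_dual_lattice_def by blast
    have "v \<in> f -` L \<longleftrightarrow> (\<forall>x\<in>f -` L. \<beta> v x \<in> local_ring p)" for v
      using L(1)[of "f v"] surjD[OF surj] iso by (metis vimage_eq)
    moreover have "\<exists>k::nat. (\<lambda>i. of_int p ^ k * v i) \<in> f -` L" for v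
      using L(2)[of "f v"] by (simp add: sc)
    ultimately show "locally_unimodular p \<beta>"
      unfolding locally_unimodular_def self_dual_lattice_def by blast
  qed
qed

subsection \<open>Invariance under hyperbolic planes\<close>

definition drop2 :: "(nat \<Rightarrow> rat) \<Rightarrow> nat \<Rightarrow> rat" where
  "drop2 x = (\<lambda>i. x (Suc (Suc i)))"

definition cons2 :: "rat \<Rightarrow> rat \<Rightarrow> (nat \<Rightarrow> rat) \<Rightarrow> nat \<Rightarrow> rat" where
  "cons2 a b x = case_nat a (case_nat b x)"

text \<open>The orthogonal sum of a hyperbolic plane, on coordinates 0 and 1, and a copy of the form
  shifted by two places.\<close>

definition add_hyperbolic ::
    "((nat \<Rightarrow> rat) \<Rightarrow> (nat \<Rightarrow> rat) \<Rightarrow> rat) \<Rightarrow> (nat \<Rightarrow> rat) \<Rightarrow> (nat \<Rightarrow> rat) \<Rightarrow> rat" where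
  "add_hyperbolic \<beta> x y = x 0 * y 1 + x 1 * y 0 + \<beta> (drop2 x) (drop2 y)"

lemma cons2_simps [simp]:
  "cons2 a b x 0 = a" "cons2 a b x (Suc 0) = b" "drop2 (cons2 a b x) = x"
  by (auto simp: cons2_def drop2_def)

lemma drop2_lincomb: "drop2 (lincomb x c y) = lincomb (drop2 x) c (drop2 y)"
  by (auto simp: drop2_def lincomb_def)

lemma lincomb_cons2: "lincomb (cons2 a b x) c (cons2 a' b' x') = cons2 (a + c * a') (b + c * b') (lincomb x c x')"
  by (auto simp: cons2_def lincomb_def split: nat.splits)

lemma cons2_drop2: "cons2 (x 0) (x (Suc 0)) (drop2 x) = x"
  by (auto simp: cons2_def drop2_def split: nat.splits)

lemma sym_bilinear_add_hyperbolic: "sym_bilinear \<beta> \<Longrightarrow> sym_bilinear (add_hyperbolic \<beta>)"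
  unfolding sym_bilinear_def add_hyperbolic_def drop2_lincomb
  by (auto simp: lincomb_def algebra_simps)

text \<open>Let e be the basis vector of coordinate 0, which is isotropic. A subspace L is enlarged
  to Qe + L. Conversely K is contracted to the image of its part orthogonal to e, the usual passage
  to the quotient of e-perp by e.\<close>

lemma witt_definite_add_hyperbolic:
  assumes \<beta>: "sym_bilinear \<beta>"
  shows "witt_definite s (add_hyperbolic \<beta>) \<longleftrightarrow> witt_definite s \<beta>"
proof
  assume "witt_definite s \<beta>"
  then obtain L where L: "L \<noteq> {}" "\<forall>x\<in>L. \<forall>y\<in>L. \<forall>c. lincomb x c y \<in> L" "\<forall>x\<in>L. \<forall>y\<in>L. \<beta> x y = 0"
    "\<And>v. \<forall>x\<in>L. \<beta> v x = 0 \<Longrightarrow> v \<in> L \<or> s * \<beta> v v > 0" unfolding witt_definite_def by blast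
  define K where "K = {x. x 1 = 0 \<and> drop2 x \<in> L}"
  have "v \<in> K \<or> s * add_hyperbolic \<beta> v v > 0" if v: "\<forall>x\<in>K. add_hyperbolic \<beta> v x = 0" for v
  proof -
    have *: "v 1 * t + \<beta> (drop2 v) z = 0" if "z \<in> L" for t z
      using bspec[OF v, of "cons2 t 0 z"] that by (simp add: K_def add_hyperbolic_def)
    obtain z where z: "z \<in> L" using L(1) by blast
    have v1: "v 1 = 0" using *[OF z, of 0] *[OF z, of 1] by simp
    then have "\<forall>x\<in>L. \<beta> (drop2 v) x = 0" using * by force
    then show ?thesis using L(4)[of "drop2 v"] v1 by (auto simp: K_def add_hyperbolic_def)
  qed
  moreover obtain z where "z \<in> L" using L(1) by blast
  then have "cons2 0 0 z \<in> K" by (simp add: K_def)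
  then have "K \<noteq> {}" by blast
  ultimately show "witt_definite s (add_hyperbolic \<beta>)"
    unfolding witt_definite_def using L(2,3)
    by (intro exI[of _ K]) (auto simp: K_def add_hyperbolic_def drop2_lincomb, auto simp: lincomb_def)
next
  assume "witt_definite s (add_hyperbolic \<beta>)"
  then obtain K where K: "K \<noteq> {}" "\<forall>x\<in>K. \<forall>y\<in>K. \<forall>c. lincomb x c y \<in> K"
    "\<forall>x\<in>K. \<forall>y\<in>K. add_hyperbolic \<beta> x y = 0"
    "\<And>v. \<forall>x\<in>K. add_hyperbolic \<beta> v x = 0 \<Longrightarrow> v \<in> K \<or> s * add_hyperbolic \<beta> v v > 0"
    unfolding witt_definite_def by blast
  define L where "L = {z. \<exists>t. cons2 t 0 z \<in> K}"
  have memL: "drop2 x \<in> L" if "x \<in> K" "x 1 = 0" for x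
    using that cons2_drop2[of x] unfolding L_def One_nat_def by (metis mem_Collect_eq)
  have "v \<in> L \<or> s * \<beta> v v > 0" if v: "\<forall>x\<in>L. \<beta> v x = 0" for v
  proof -
    \<comment> \<open>Lifts v to a vector orthogonal to all of K: orthogonality to one w outside
      e-perp fixes c, and every x in K differs from a multiple of w by a vector of e-perp.\<close>
    have "\<exists>c. \<forall>x\<in>K. add_hyperbolic \<beta> (cons2 c 0 v) x = 0"
    proof (cases "\<forall>x\<in>K. x 1 = 0")
      case True
      then show ?thesis using memL v by (intro exI[of _ 0]) (auto simp: add_hyperbolic_def)
    next
      case False
      then obtain w where w: "w \<in> K" "w 1 \<noteq> 0" by blast
      have "add_hyperbolic \<beta> (cons2 (- \<beta> v (drop2 w) / w 1) 0 v) x = 0" if x: "x \<in> K" for x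
      proof -
        have "lincomb x (- x 1 / w 1) w \<in> K" using x w K(2) by blast
        then have "drop2 (lincomb x (- x 1 / w 1) w) \<in> L" using w
          by (intro memL) (auto simp: lincomb_def)
        then have "\<beta> v (drop2 (lincomb x (- x 1 / w 1) w)) = 0" using v by blast
        then have "\<beta> v (drop2 x) - x 1 / w 1 * \<beta> v (drop2 w) = 0"
          by (simp add: drop2_lincomb sym_bilinear_right[OF \<beta>])
        then show ?thesis by (simp add: add_hyperbolic_def)
      qed
      then show ?thesis by blast
    qed
    then obtain c where "\<forall>x\<in>K. add_hyperbolic \<beta> (cons2 c 0 v) x = 0" by blast
    from K(4)[OF this] show ?thesis by (auto simp: add_hyperbolic_def L_def)
  qed
  moreover have "L \<noteq> {}"
  proof -
    obtain x where "x \<in> K" using K(1) by blast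
    then have "lincomb x (-1) x \<in> K" using K(2) by blast
    then show ?thesis using memL[of "lincomb x (-1) x"] by (auto simp: lincomb_def)
  qed
  moreover have "lincomb x c y \<in> L" if xy: "x \<in> L" "y \<in> L" for x y c
  proof -
    obtain t t' where "cons2 t 0 x \<in> K" "cons2 t' 0 y \<in> K" using xy unfolding L_def by blast
    then have "lincomb (cons2 t 0 x) c (cons2 t' 0 y) \<in> K" using K(2) by blast
    then show ?thesis unfolding L_def lincomb_cons2 by auto
  qed
  moreover have "\<beta> x y = 0" if xy: "x \<in> L" "y \<in> L" for x y
  proof -
    obtain t t' where "cons2 t 0 x \<in> K" "cons2 t' 0 y \<in> K" using xy unfolding L_def by blast
    then have "add_hyperbolic \<beta> (cons2 t 0 x) (cons2 t' 0 y) = 0" using K(3) by blast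
    then show ?thesis by (simp add: add_hyperbolic_def)
  qed
  ultimately show "witt_definite s \<beta>" unfolding witt_definite_def
    by (intro exI[of _ L]) blast
qed

lemma self_dual_lattice_lincomb:
  assumes "prime p" "sym_bilinear \<beta>" "self_dual_lattice p \<beta> L" "x \<in> L" "y \<in> L" "c \<in> local_ring p"
  shows "lincomb x c y \<in> L"
proof -
  have "\<beta> (lincomb x c y) z \<in> local_ring p" if "z \<in> L" for z
  proof -
    have "\<beta> x z \<in> local_ring p" "\<beta> y z \<in> local_ring p"
      using assms that unfolding self_dual_lattice_def by blast+
    then show ?thesis using assms(1,2,6) by (simp add: sym_bilinear_left local_ring_add local_ring_mult)
  qed
  then show ?thesis using assms(3) unfolding self_dual_lattice_def by blast
qed

lemma self_dual_lattice_zero: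
  assumes "prime p" "sym_bilinear \<beta>" "self_dual_lattice p \<beta> L" shows "(\<lambda>i. 0) \<in> L"
proof -
  have "\<beta> (\<lambda>i. 0) x = 0" for x
    using sym_bilinear_left[OF assms(2), of x "-1" x x] by (simp add: lincomb_def)
  then have "\<forall>x\<in>L. \<beta> (\<lambda>i. 0) x \<in> local_ring p" using assms(1) by simp
  then show ?thesis using assms(3) unfolding self_dual_lattice_def by blast
qed

lemma sym_bilinear_scale: "sym_bilinear \<beta> \<Longrightarrow> \<beta> x (\<lambda>i. c * y i) = c * \<beta> x y"
  using sym_bilinear_right[of \<beta> x y "c - 1" y] by (simp add: lincomb_def algebra_simps)

text \<open>Some multiple p^k e lies in L, so the pairings of L with e have bounded denominators and
  one of them divides all others.\<close>

lemma self_dual_lattice_functional: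
  assumes p: "prime p" and \<beta>: "sym_bilinear \<beta>" and L: "self_dual_lattice p \<beta> L"
    and x: "x \<in> L" "\<beta> x e \<noteq> 0"
  shows "\<exists>w\<in>L. \<beta> w e \<noteq> 0 \<and> (\<forall>x\<in>L. \<beta> x e / \<beta> w e \<in> local_ring p)"
proof -
  obtain k where "(\<lambda>i. of_int p ^ k * e i) \<in> L"
    using L unfolding self_dual_lattice_def by blast
  then have "of_int p ^ k * \<beta> x e \<in> local_ring p" if "x \<in> L" for x
    using L that unfolding self_dual_lattice_def by (metis sym_bilinear_scale[OF \<beta>])
  then show ?thesis
    using bounded_fractional_ideal_principal[OF p, of "\<beta> x e" "(\<lambda>x. \<beta> x e) ` L" k] x by auto
qed

text \<open>The contraction along e is that of \<open>witt_definite_add_hyperbolic\<close>, but x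
  may be corrected only by integral multiples of w. Hence w is taken with coordinate 1, its pairing
  with e, of smallest valuation.\<close>

lemma locally_unimodular_add_hyperbolic:
  assumes p: "prime p" and \<beta>: "sym_bilinear \<beta>"
  shows "locally_unimodular p (add_hyperbolic \<beta>) \<longleftrightarrow> locally_unimodular p \<beta>"
proof
  assume "locally_unimodular p \<beta>"
  then obtain L where sd: "self_dual_lattice p \<beta> L" unfolding locally_unimodular_def by blast
  then have L: "\<And>v. v \<in> L \<longleftrightarrow> (\<forall>x\<in>L. \<beta> v x \<in> local_ring p)"
    "\<And>v. \<exists>k::nat. (\<lambda>i. of_int p ^ k * v i) \<in> L"
    unfolding self_dual_lattice_def by blast+
  have L0: "(\<lambda>i. 0) \<in> L" using self_dual_lattice_zero[OF p \<beta> sd] .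
  have b0: "\<beta> v (\<lambda>i. 0) = 0" for v using sym_bilinear_scale[OF \<beta>, of v 0 v] by simp
  define K where "K = {x. x 0 \<in> local_ring p \<and> x 1 \<in> local_ring p \<and> drop2 x \<in> L}"
  have "v \<in> K" if v: "\<forall>x\<in>K. add_hyperbolic \<beta> v x \<in> local_ring p" for v
  proof -
    have "cons2 1 0 (\<lambda>i. 0) \<in> K" "cons2 0 1 (\<lambda>i. 0) \<in> K" using L0 p by (auto simp: K_def)
    then have "v 0 \<in> local_ring p" "v 1 \<in> local_ring p" using v b0 by (fastforce simp: add_hyperbolic_def)+
    moreover have "\<beta> (drop2 v) z \<in> local_ring p" if "z \<in> L" for z
      using bspec[OF v, of "cons2 0 0 z"] that p by (simp add: K_def add_hyperbolic_def)
    ultimately show ?thesis using L(1)[of "drop2 v"] unfolding K_def by blast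
  qed
  moreover have "add_hyperbolic \<beta> v x \<in> local_ring p" if "v \<in> K" "x \<in> K" for v x
    proof -
    have "\<beta> (drop2 v) (drop2 x) \<in> local_ring p" using that L(1)[of "drop2 v"] unfolding K_def by blast
    then show ?thesis using that p unfolding K_def add_hyperbolic_def
      by (auto intro!: local_ring_add local_ring_mult)
  qed
  moreover have "\<exists>k::nat. (\<lambda>i. of_int p ^ k * v i) \<in> K" for v
  proof -
    obtain a b c where abc: "of_int p ^ a * v 0 \<in> local_ring p" "of_int p ^ b * v 1 \<in> local_ring p"
      "(\<lambda>i. of_int p ^ c * drop2 v i) \<in> L"
      using ex_power_mult_local_ring[OF p] L(2) by meson
    have pw: "of_int p ^ k \<in> local_ring p" for k using p by (simp add: local_ring_power)
    have "of_int p ^ (b + c) * (of_int p ^ a * v 0) \<in> local_ring p"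
      "of_int p ^ (a + c) * (of_int p ^ b * v 1) \<in> local_ring p"
      using abc pw local_ring_mult[OF p] by blast+
    moreover have "lincomb (\<lambda>i. 0) (of_int p ^ (a + b)) (\<lambda>i. of_int p ^ c * drop2 v i) \<in> L"
      using self_dual_lattice_lincomb[OF p \<beta> sd L0 abc(3) pw] .
    ultimately have "(\<lambda>i. of_int p ^ (a + b + c) * v i) \<in> K"
      by (simp add: K_def lincomb_def drop2_def power_add mult_ac)
    then show ?thesis by blast
  qed
  ultimately show "locally_unimodular p (add_hyperbolic \<beta>)"
    unfolding locally_unimodular_def self_dual_lattice_def by blast
next
  note H = sym_bilinear_add_hyperbolic[OF \<beta>]
  assume "locally_unimodular p (add_hyperbolic \<beta>)"
  then obtain K where sd: "self_dual_lattice p (add_hyperbolic \<beta>) K"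
    unfolding locally_unimodular_def by blast
  then have K: "\<And>v. v \<in> K \<longleftrightarrow> (\<forall>x\<in>K. add_hyperbolic \<beta> v x \<in> local_ring p)"
    "\<And>v. \<exists>k::nat. (\<lambda>i. of_int p ^ k * v i) \<in> K"
    unfolding self_dual_lattice_def by blast+
  define L where "L = {z. \<exists>t. cons2 t 0 z \<in> K}"
  have memL: "drop2 x \<in> L" if "x \<in> K" "x 1 = 0" for x
    using that cons2_drop2[of x] unfolding L_def One_nat_def by (metis mem_Collect_eq)
  have b0: "\<beta> (\<lambda>i. 0) v = 0" for v
    using sym_bilinear_left[OF \<beta>, of v "-1" v v] by (simp add: lincomb_def)
  have e: "add_hyperbolic \<beta> x (cons2 1 0 (\<lambda>i. 0)) = x 1" for x
    using b0 sym_bilinear_sym[OF \<beta>, of "drop2 x" "\<lambda>i. 0"] by (simp add: add_hyperbolic_def)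
  have "v \<in> L" if v: "\<forall>x\<in>L. \<beta> v x \<in> local_ring p" for v
  proof -
    have "\<exists>c. \<forall>x\<in>K. add_hyperbolic \<beta> (cons2 c 0 v) x \<in> local_ring p"
    proof (cases "\<forall>x\<in>K. x 1 = 0")
      case True
      then show ?thesis using memL v by (intro exI[of _ 0]) (auto simp: add_hyperbolic_def)
    next
      case False
      then obtain w where w: "w \<in> K" "w 1 \<noteq> 0" and gen: "\<forall>x\<in>K. x 1 / w 1 \<in> local_ring p"
        using self_dual_lattice_functional[OF p H sd, of _ "cons2 1 0 (\<lambda>i. 0)"] unfolding e by blast
      have "add_hyperbolic \<beta> (cons2 (- \<beta> v (drop2 w) / w 1) 0 v) x \<in> local_ring p" if x: "x \<in> K" for x
      proof -
        have "lincomb x (- x 1 / w 1) w \<in> K" using x w gen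
          local_ring_uminus[OF p] by (intro self_dual_lattice_lincomb[OF p H sd]) fastforce+
        then have "drop2 (lincomb x (- x 1 / w 1) w) \<in> L" using w
          by (intro memL) (auto simp: lincomb_def)
        then have "\<beta> v (drop2 x) - x 1 / w 1 * \<beta> v (drop2 w) \<in> local_ring p"
          using v by (force simp: drop2_lincomb sym_bilinear_right[OF \<beta>])
        then show ?thesis by (simp add: add_hyperbolic_def mult.commute)
      qed
      then show ?thesis by blast
    qed
    then show ?thesis unfolding L_def using K(1) by blast
  qed
  moreover have "\<beta> x y \<in> local_ring p" if xy: "x \<in> L" "y \<in> L" for x y
  proof -
    obtain t t' where "cons2 t 0 x \<in> K" "cons2 t' 0 y \<in> K" using xy unfolding L_def by blast
    then have "add_hyperbolic \<beta> (cons2 t 0 x) (cons2 t' 0 y) \<in> local_ring p" using K(1) by blast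
    then show ?thesis by (simp add: add_hyperbolic_def)
  qed
  moreover have "\<exists>k::nat. (\<lambda>i. of_int p ^ k * v i) \<in> L" for v
  proof -
    obtain k where "(\<lambda>i. of_int p ^ k * cons2 0 0 v i) \<in> K" using K(2) by blast
    from memL[OF this] show ?thesis by (intro exI[of _ k]) (simp add: drop2_def cons2_def)
  qed
  ultimately show "locally_unimodular p \<beta>"
    unfolding locally_unimodular_def self_dual_lattice_def by blast
qed

section \<open>Witt equivalence of diagonal forms\<close>

definition diag_form :: "int list \<Rightarrow> (nat \<Rightarrow> rat) \<Rightarrow> (nat \<Rightarrow> rat) \<Rightarrow> rat" where
  "diag_form l x y = (\<Sum>i<length l. of_int (l ! i) * x i * y i)"

lemma diag_form_Cons:
  "diag_form (a # l) x y = of_int a * x 0 * y 0 + diag_form l (\<lambda>i. x (Suc i)) (\<lambda>i. y (Suc i))"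
  by (simp add: diag_form_def sum.lessThan_Suc_shift del: sum.lessThan_Suc)

lemma sym_bilinear_diag_form: "sym_bilinear (diag_form l)"
  by (simp add: sym_bilinear_def diag_form_def lincomb_def algebra_simps sum.distrib sum_distrib_left)

text \<open>Only the two properties that the reduction has to transport are compared, rather than
  Witt classes themselves.\<close>

definition same_invariants :: "int list \<Rightarrow> int list \<Rightarrow> bool" where
  "same_invariants l l' \<longleftrightarrow>
     (\<forall>s. witt_definite s (diag_form l) \<longleftrightarrow> witt_definite s (diag_form l')) \<and>
     (\<forall>p. prime p \<longrightarrow> locally_unimodular p (diag_form l) \<longleftrightarrow> locally_unimodular p (diag_form l'))"

lemma same_invariants_isometry:
  assumes "\<And>x c y. f (lincomb x c y) = lincomb (f x) c (f y)" "surj f"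
    "\<And>x y. diag_form l' (f x) (f y) = diag_form l x y"
  shows "same_invariants l l'"
  unfolding same_invariants_def using isometry_transfer[of f "diag_form l'" "diag_form l", OF assms] by blast

lemma same_invariants_perm:
  assumes "mset l = mset l'" shows "same_invariants l l'"
proof -
  obtain f where f: "bij_betw f {..<length l} {..<length l'}" "\<forall>i<length l. l ! i = l' ! f i"
    using permutation_Ex_bij[of l l'] assms by auto
  define g where "g i = (if i < length l then f i else i)" for i
  have len: "length l = length l'" using assms by (metis size_mset)
  have fin: "g i < length l \<longleftrightarrow> i < length l" for i
    using f(1) len by (auto simp: g_def dest: bij_betwE)
  have "bij_betw g {..<length l} {..<length l}"
    using f(1) len by (metis (no_types, lifting) bij_betw_cong g_def lessThan_iff)
  moreover have "bij_betw g (- {..<length l}) (- {..<length l})"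
    by (rule bij_betwI[of _ _ _ "\<lambda>i. i"]) (auto simp: g_def)
  ultimately have "bij_betw g ({..<length l} \<union> - {..<length l}) ({..<length l} \<union> - {..<length l})"
    by (rule bij_betw_combine) auto
  then have bij: "bij g" by (simp only: Compl_partition)
  have "same_invariants l' l"
  proof (rule same_invariants_isometry[where f = "\<lambda>x i. x (g i)"])
    show "surj (\<lambda>x i. x (g i) :: rat)"
    proof (rule surjI)
      fix x :: "nat \<Rightarrow> rat"
      show "(\<lambda>i. (\<lambda>i. x (inv g i)) (g i)) = x" using bij by (simp add: bij_is_inj)
    qed
    fix x y
    have "diag_form l (\<lambda>i. x (g i)) (\<lambda>i. y (g i)) = (\<Sum>i<length l. of_int (l' ! f i) * x (f i) * y (f i))"
      unfolding diag_form_def using f(2) by (intro sum.cong) (auto simp: g_def)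
    also have "\<dots> = diag_form l' x y"
      unfolding diag_form_def by (rule sum.reindex_bij_betw[OF f(1)])
    finally show "diag_form l (\<lambda>i. x (g i)) (\<lambda>i. y (g i)) = diag_form l' x y" .
  qed (simp add: lincomb_def)
  then show ?thesis by (auto simp: same_invariants_def)
qed

text \<open>The relation compares invariants of complete forms and is not by definition compatible
  with adding summands; the rules below therefore carry a context \<open>M\<close>.\<close>

definition witt_equiv :: "int multiset \<Rightarrow> int multiset \<Rightarrow> bool" where
  "witt_equiv M N \<longleftrightarrow> (\<forall>l l'. mset l = M \<longrightarrow> mset l' = N \<longrightarrow> same_invariants l l')"

lemma witt_equivI: "same_invariants l l' \<Longrightarrow> witt_equiv (mset l) (mset l')"
  unfolding witt_equiv_def using same_invariants_perm unfolding same_invariants_def by metis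

lemma witt_equiv_refl [simp]: "witt_equiv M M"
  unfolding witt_equiv_def using same_invariants_perm by auto

lemma witt_equiv_sym: "witt_equiv M N \<Longrightarrow> witt_equiv N M"
  unfolding witt_equiv_def same_invariants_def by auto

lemma witt_equiv_trans [trans]: "witt_equiv M N \<Longrightarrow> witt_equiv N K \<Longrightarrow> witt_equiv M K"
  unfolding witt_equiv_def same_invariants_def by (metis ex_mset)

section \<open>Basic relations between diagonal forms\<close>

lemma witt_equiv_square:
  assumes "k \<noteq> 0" shows "witt_equiv (add_mset (a * k\<^sup>2) M) (add_mset a M)"
proof -
  obtain l where l: "mset l = M" by (metis ex_mset)
  define f :: "(nat \<Rightarrow> rat) \<Rightarrow> nat \<Rightarrow> rat" where "f x = x(0 := of_int k * x 0)" for x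
  have "same_invariants (a * k\<^sup>2 # l) (a # l)"
  proof (rule same_invariants_isometry[where f = f])
    show "surj f"
    proof (rule surjI)
      show "f (x(0 := x 0 / of_int k)) = x" for x using assms by (auto simp: f_def)
    qed
  qed (auto simp: f_def lincomb_def diag_form_Cons algebra_simps power2_eq_square fun_eq_iff)
  from witt_equivI[OF this] show ?thesis using l by simp
qed

text \<open>In the plane with diagonal entries a and b, the orthogonal vectors (1, 1) and (b, -a)
  have norms a + b and ab(a + b); they form a basis when a + b is nonzero.\<close>

lemma witt_equiv_binary:
  assumes "a + b \<noteq> 0" 
  shows "witt_equiv (add_mset a (add_mset b M)) (add_mset (a + b) (add_mset (a * b * (a + b)) M))"
proof -
  obtain l where l: "mset l = M" by (metis ex_mset)
  define A B where "A = (of_int a :: rat)" and "B = (of_int b :: rat)"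
  have AB: "A + B \<noteq> 0" using assms unfolding A_def B_def by (metis of_int_add of_int_eq_0_iff)
  define f :: "(nat \<Rightarrow> rat) \<Rightarrow> nat \<Rightarrow> rat"
    where "f x = x(0 := x 0 + B * x 1, Suc 0 := x 0 - A * x 1)" for x
  have "same_invariants ((a + b) # (a * b * (a + b)) # l) (a # b # l)"
  proof (rule same_invariants_isometry[where f = f])
    show "surj f"
    proof (rule surjI)
      fix x :: "nat \<Rightarrow> rat"
      define y1 where "y1 = (x 0 - x 1) / (A + B)"
      have "y1 * (A + B) = x 0 - x 1" using AB by (simp add: y1_def)
      then show "f (x(0 := x 0 - B * y1, Suc 0 := y1)) = x" 
        by (auto simp: f_def fun_eq_iff algebra_simps)
    qed
    fix x y
    show "diag_form (a # b # l) (f x) (f y) = diag_form ((a + b) # (a * b * (a + b)) # l) x y"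
      by (simp add: f_def diag_form_Cons A_def[symmetric] B_def[symmetric]) algebra
  qed (auto simp: f_def lincomb_def fun_eq_iff algebra_simps)
  from witt_equiv_sym[OF witt_equivI[OF this]] show ?thesis using l by simp
qed

text \<open>Writing a x^2 - a y^2 as twice the product of (x + y)/2 and a(x - y) exhibits the pair
  as a hyperbolic plane.\<close>

lemma witt_equiv_hyperbolic:
  assumes "a \<noteq> 0" shows "witt_equiv (add_mset a (add_mset (- a) M)) M"
proof -
  obtain l where l: "mset l = M" by (metis ex_mset)
  define A where "A = (of_int a :: rat)"
  have A: "A \<noteq> 0" using assms by (simp add: A_def)
  define f :: "(nat \<Rightarrow> rat) \<Rightarrow> nat \<Rightarrow> rat"
    where "f x = x(0 := (x 0 + x 1) / 2, Suc 0 := A * (x 0 - x 1))" for x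
  have lin: "f (lincomb x c y) = lincomb (f x) c (f y)" for x c y
    by (auto simp: f_def lincomb_def fun_eq_iff algebra_simps add_divide_distrib)
  have surj: "surj f"
  proof (rule surjI)
    fix x :: "nat \<Rightarrow> rat"
    show "f (x(0 := x 0 + x 1 / (2 * A), Suc 0 := x 0 - x 1 / (2 * A))) = x" 
      using A by (auto simp: f_def fun_eq_iff field_simps)
  qed
  have iso: "add_hyperbolic (diag_form l) (f x) (f y) = diag_form (a # - a # l) x y" for x y
    by (simp add: add_hyperbolic_def f_def diag_form_Cons A_def[symmetric] drop2_def) (simp add: field_simps)
  have "same_invariants (a # - a # l) l"
    unfolding same_invariants_def 
    using isometry_transfer[of f "add_hyperbolic (diag_form l)" "diag_form (a # - a # l)", OF lin surj iso]
      witt_definite_add_hyperbolic[OF sym_bilinear_diag_form[of l]]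
      locally_unimodular_add_hyperbolic[OF _ sym_bilinear_diag_form[of l]] by blast
  from witt_equivI[OF this] show ?thesis using l by simp
qed

section \<open>Eliminating the largest prime\<close>

text \<open>The strict bound makes \<open>smooth p\<close> exclude the prime p itself, and leaves
  only 1 and -1 for the bound 0.\<close>

definition smooth :: "int \<Rightarrow> int \<Rightarrow> bool" where
  "smooth P a \<longleftrightarrow> a \<noteq> 0 \<and> (\<forall>q. prime q \<longrightarrow> q dvd a \<longrightarrow> q < P)"

lemma smooth_mult [simp]: "smooth P (a * b) \<longleftrightarrow> smooth P a \<and> smooth P b"
  unfolding smooth_def by (auto simp: prime_dvd_mult_iff)

lemma smooth_uminus [simp]: "smooth P (- a) \<longleftrightarrow> smooth P a"
  by (simp add: smooth_def)

lemma smooth_small: "a \<noteq> 0 \<Longrightarrow> \<bar>a\<bar> < P \<Longrightarrow> smooth P a"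
  unfolding smooth_def by (metis abs_dvd_iff dvd_abs_iff zdvd_imp_le abs_of_nonneg prime_ge_0_int
      zero_less_abs_iff order.strict_trans1)

lemma smooth_not_dvd: "smooth p a \<Longrightarrow> prime p \<Longrightarrow> \<not> p dvd a"
  unfolding smooth_def by auto

text \<open>Modulo smaller primes \<open>\<langle>pm\<rangle>\<close> depends only on \<open>m\<close> modulo \<open>p\<close>, because
  \<open>\<langle>pr\<rangle> + \<langle>p\<^sup>2l\<rangle> = \<langle>p(r + pl)\<rangle> + \<langle>rl(r + pl)\<rangle>\<close> up to squares.\<close>

lemma witt_equiv_residue_step:
  assumes "prime p" "smooth p m" "smooth p r" "smooth p t" "m - r = l * p" "\<bar>l\<bar> < p"
  shows "\<exists>T. (\<forall>x\<in>#T. smooth p x) \<and> witt_equiv (add_mset (p * m * t) M) (add_mset (p * r * t) (T + M))"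
proof (cases "l = 0")
  case True
  then show ?thesis using assms by (intro exI[of _ "{#}"]) auto
next
  case False
  \<comment> \<open>The binary relation for \<open>p * r * t\<close> and
    \<open>l * t * p\<^sup>2\<close> needs a second entry on the other side, which equals
    \<open>c\<close> up to a square. Inserting \<open>c\<close> and \<open>- c\<close> supplies it;
    \<open>- c\<close> remains as a correction.\<close>
  define c where "c = r * l * m * t"
  have sl: "smooth p l" using False assms by (intro smooth_small) auto
  have sc: "smooth p c" using sl assms by (simp add: c_def)
  have nz: "p \<noteq> 0" "t \<noteq> 0" "m \<noteq> 0" "c \<noteq> 0" using assms sc by (auto simp: smooth_def)
  have sum: "p * r * t + l * t * p\<^sup>2 = p * m * t"
  proof -
    have "m = r + l * p" using assms(5) by simp
    then show ?thesis by (simp add: algebra_simps power2_eq_square)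
  qed
  have prod: "p * r * t * (l * t * p\<^sup>2) * (p * m * t) = c * (p\<^sup>2 * t)\<^sup>2"
    by (simp add: c_def power2_eq_square algebra_simps)
  let ?N = "add_mset (- c) M"
  have "witt_equiv (add_mset (p * m * t) M) (add_mset (p * m * t) (add_mset c ?N))"
    using witt_equiv_sym[OF witt_equiv_hyperbolic[OF nz(4), of "add_mset (p * m * t) M"]]
    by (simp add: add_mset_commute)
  also have "witt_equiv \<dots> (add_mset (p * m * t) (add_mset (c * (p\<^sup>2 * t)\<^sup>2) ?N))"
    using witt_equiv_sym[OF witt_equiv_square[of "p\<^sup>2 * t" c "add_mset (p * m * t) ?N"]] nz
    by (simp add: add_mset_commute)
  also have "witt_equiv \<dots> (add_mset (p * r * t) (add_mset (l * t * p\<^sup>2) ?N))"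
    using witt_equiv_sym[OF witt_equiv_binary[of "p * r * t" "l * t * p\<^sup>2" ?N]] nz unfolding sum prod by simp
  also have "witt_equiv \<dots> (add_mset (p * r * t) (add_mset (l * t) ?N))"
    using witt_equiv_square[of p "l * t" "add_mset (p * r * t) ?N"] nz by (simp add: add_mset_commute)
  finally show ?thesis using sc sl assms
    by (intro exI[of _ "{#l * t, - c#}"]) (auto simp: add_mset_commute)
qed

text \<open>One step needs |l| < p to keep its corrections smooth. For large m a prime q < p is
  split off m and stored in t, the cofactor is replaced by its residue r' by induction, and then
  |qr' - r| <= (p - 1)p permits one more step from qr' to r.\<close>

lemma witt_equiv_residue:
  assumes "prime p" "smooth p m" "smooth p t" "r \<noteq> 0" "\<bar>r\<bar> < p" "p dvd m - r"
  shows "\<exists>T. (\<forall>x\<in>#T. smooth p x) \<and> witt_equiv (add_mset (p * m * t) M) (add_mset (p * r * t) (T + M))"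
  using assms(2-6)
proof (induction "nat \<bar>m\<bar>" arbitrary: m r t M rule: less_induct)
  case less
  have p: "p > 1" using assms(1) prime_gt_1_int by blast
  have sr: "smooth p r" using less by (intro smooth_small) auto
  show ?case
  proof (cases "\<bar>m\<bar> < p")
    case True
    obtain l where l: "m - r = l * p" using less.prems(5) by (metis dvdE mult.commute)
    have "\<bar>l\<bar> * p = \<bar>m - r\<bar>" using p l by (simp add: abs_mult)
    then have "\<bar>l\<bar> * p < 2 * p" using True less.prems(4) by linarith
    then have "\<bar>l\<bar> < p" using p by simp
    then show ?thesis using witt_equiv_residue_step[OF assms(1) less.prems(1) sr less.prems(2) l] by blast
  next
    case False
    then have "\<bar>m\<bar> \<noteq> 1" using p by linarith
    then obtain q where q: "prime q" "q dvd m" using prime_factor_int by blast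
    then obtain m' where m': "m = q * m'" by blast
    have q1: "q > 1" using q prime_gt_1_int by blast
    have qp: "q < p" using q less.prems(1) unfolding smooth_def by blast
    have sm': "smooth p m'" and sq: "smooth p q" using less.prems(1) m' by auto
    then have "m' \<noteq> 0" by (auto simp: smooth_def)
    then have "\<bar>m'\<bar> < \<bar>m\<bar>" unfolding m' using q1 by (simp add: abs_mult)
    then have lt: "nat \<bar>m'\<bar> < nat \<bar>m\<bar>" by simp
    define r' where "r' = m' mod p"
    have r': "0 < r'" "r' < p"
      using smooth_not_dvd[OF sm' assms(1)] p
      by (auto simp: r'_def dvd_eq_mod_eq_0 order.strict_iff_order[of 0])
    have dv: "p dvd m' - r'" by (simp add: r'_def)
    obtain T1 where T1: "\<forall>x\<in>#T1. smooth p x"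
      "witt_equiv (add_mset (p * m' * (q * t)) M) (add_mset (p * r' * (q * t)) (T1 + M))"
      using less.hyps[OF lt sm' _ _ _ dv, of "q * t" M] less.prems(2) sq r' by auto
    have "q * r' - r = (m - r) - q * (m' - r')" by (simp add: m' algebra_simps)
    then have "p dvd q * r' - r" using less.prems(5) dv by (metis dvd_diff dvd_mult)
    then obtain l where l: "q * r' - r = l * p" by (metis dvdE mult.commute)
    have "q * r' \<le> (p - 1) * (p - 1)" using qp r' q1 by (intro mult_mono) auto
    moreover have "0 \<le> q * r'" using q1 r' by simp
    ultimately have "\<bar>q * r' - r\<bar> \<le> (p - 1) * (p - 1) + (p - 1)" using less.prems(4) by linarith
    also have "\<dots> = (p - 1) * p" by (simp add: algebra_simps)
    finally have "\<bar>l\<bar> * p \<le> (p - 1) * p" unfolding l using p by (simp add: abs_mult)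
    then have "\<bar>l\<bar> < p" using p by (simp add: mult_le_cancel_right)
    moreover have "smooth p (q * r')" using sq smooth_small[of r' p] r' by simp
    ultimately obtain T2 where T2: "\<forall>x\<in>#T2. smooth p x"
      "witt_equiv (add_mset (p * (q * r') * t) (T1 + M)) (add_mset (p * r * t) (T2 + (T1 + M)))"
      using witt_equiv_residue_step[OF assms(1) _ sr less.prems(2) l, of "T1 + M"] by blast
    have "witt_equiv (add_mset (p * m * t) M) (add_mset (p * r' * (q * t)) (T1 + M))"
      using T1(2) by (simp add: m' mult_ac)
    also have "witt_equiv \<dots> (add_mset (p * r * t) (T2 + (T1 + M)))"
      using T2(2) by (simp add: mult_ac)
    finally show ?thesis using T1 T2 by (intro exI[of _ "T2 + T1"]) (auto simp: ac_simps)
  qed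
qed

text \<open>A square factor does not matter, so u may be replaced by u c^2, of which only the
  residue counts; reducing c modulo p first makes it smooth.\<close>

lemma witt_equiv_residue_square:
  assumes "prime p" "smooth p u" "\<not> p dvd c" "r \<noteq> 0" "\<bar>r\<bar> < p" "p dvd u * c\<^sup>2 - r"
  shows "\<exists>T. (\<forall>x\<in>#T. smooth p x) \<and> witt_equiv (add_mset (p * u) M) (add_mset (p * r) (T + M))"
proof -
  have p: "p > 1" using assms(1) prime_gt_1_int by blast
  define d where "d = c mod p"
  have d: "d \<noteq> 0" "\<bar>d\<bar> < p" using assms(3) p by (auto simp: d_def dvd_eq_mod_eq_0)
  then have sd: "smooth p d" by (rule smooth_small)
  have "p dvd c - d" by (simp add: d_def)
  then have "p dvd (c - d) * (u * (c + d))" by simp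
  moreover have "u * d\<^sup>2 - r = (u * c\<^sup>2 - r) - (c - d) * (u * (c + d))"
    by (simp add: power2_eq_square algebra_simps)
  ultimately have "p dvd u * d\<^sup>2 - r" using assms(6) by (metis dvd_diff)
  moreover have "smooth p (u * d\<^sup>2)" using sd assms(2) by (simp add: power2_eq_square)
  moreover have "smooth p 1" using p by (intro smooth_small) auto
  ultimately obtain T where T: "\<forall>x\<in>#T. smooth p x"
    "witt_equiv (add_mset (p * (u * d\<^sup>2) * 1) M) (add_mset (p * r * 1) (T + M))"
    using witt_equiv_residue[OF assms(1) _ _ assms(4,5)] by blast
  have "witt_equiv (add_mset (p * u) M) (add_mset (p * u * d\<^sup>2) M)"
    using witt_equiv_sym[OF witt_equiv_square[OF d(1)]] .
  also have "witt_equiv \<dots> (add_mset (p * r) (T + M))" using T(2) by (simp add: mult_ac)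
  finally show ?thesis using T(1) by blast
qed

text \<open>A pair (u, c) is an entry pu with its coordinate c in a nontrivial zero modulo p. Two
  coordinates prime to p are merged into one at a time. Since one such coordinate alone cannot give
  a zero, two entries must finally cancel as a hyperbolic plane, and this lowers the number of
  entries divisible by p.\<close>

lemma witt_equiv_isotropic_residue:
  assumes "prime p" "\<forall>(u, c)\<in>#X. smooth p u" "p dvd (\<Sum>(u, c)\<in>#X. u * c\<^sup>2)"
    "\<exists>(u, c)\<in>#X. \<not> p dvd c"
  shows "\<exists>U T. size U < size X \<and> (\<forall>u\<in>#U. smooth p u) \<and> (\<forall>t\<in>#T. smooth p t) \<and>
    witt_equiv (image_mset (\<lambda>(u, c). p * u) X + M) (image_mset ((*) p) U + (T + M))"
  using assms(2-4)
proof (induction "size (filter_mset (\<lambda>(u, c). \<not> p dvd c) X)" arbitrary: X M rule: less_induct)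
  case less
  have p: "p > 1" using assms(1) prime_gt_1_int by blast
  obtain u1 c1 where "(u1, c1) \<in># X" and c1: "\<not> p dvd c1" using less.prems(3) by blast
  then obtain X1 where X1: "X = add_mset (u1, c1) X1" by (metis insert_DiffM)
  have su1: "smooth p u1" using less.prems(1) X1 by auto
  have nd: "\<not> p dvd u * c\<^sup>2" if "smooth p u" "\<not> p dvd c" for u c
    using that assms(1) smooth_not_dvd by (auto simp: prime_dvd_mult_iff prime_dvd_power_iff)
  \<comment> \<open>If every other coordinate were divisible by p, the sum would be u1 c1^2 modulo
    p, which is not zero.\<close>
  have "\<exists>(u, c)\<in>#X1. \<not> p dvd c"
  proof (rule ccontr)
    assume "\<not> ?thesis"
    then have "\<forall>x\<in>#X1. p dvd (\<lambda>(u, c). u * c\<^sup>2) x" by (fastforce simp: power2_eq_square)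
    then have "p dvd (\<Sum>(u, c)\<in>#X1. u * c\<^sup>2)" by (induction X1) auto
    moreover have "p dvd u1 * c1\<^sup>2 + (\<Sum>(u, c)\<in>#X1. u * c\<^sup>2)" using less.prems(2) X1 by simp
    ultimately have "p dvd u1 * c1\<^sup>2" by (simp add: dvd_add_left_iff)
    then show False using nd su1 c1 by blast
  qed
  then obtain u2 c2 where "(u2, c2) \<in># X1" and c2: "\<not> p dvd c2" by blast
  then obtain X2 where X2: "X1 = add_mset (u2, c2) X2" by (metis insert_DiffM)
  have su2: "smooth p u2" using less.prems(1) X1 X2 by auto
  \<comment> \<open>Representatives of opposite sign, so that their sum is again smaller than \<open>p\<close>.\<close>
  define r1 where "r1 = (u1 * c1\<^sup>2) mod p"
  define r2 where "r2 = (u2 * c2\<^sup>2) mod p - p"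
  have r1: "0 < r1" "r1 < p" using nd[OF su1 c1] p
    by (auto simp: r1_def dvd_eq_mod_eq_0 order.strict_iff_order[of 0])
  have r2: "- p < r2" "r2 < 0" using nd[OF su2 c2] p
    by (auto simp: r2_def dvd_eq_mod_eq_0 order.strict_iff_order[of 0])
  have d1: "p dvd u1 * c1\<^sup>2 - r1" by (simp add: r1_def)
  have d2: "p dvd u2 * c2\<^sup>2 - r2"
  proof -
    have "u2 * c2\<^sup>2 - r2 = (u2 * c2\<^sup>2 - (u2 * c2\<^sup>2) mod p) + p" by (simp add: r2_def)
    then show ?thesis by (metis dvd_add dvd_minus_mod dvd_refl)
  qed
  have b1: "r1 \<noteq> 0" "\<bar>r1\<bar> < p" and b2: "r2 \<noteq> 0" "\<bar>r2\<bar> < p" using r1 r2 by auto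
  let ?I = "image_mset (\<lambda>(u, c). p * u)"
  let ?R = "?I X2 + M"
  obtain T1 where T1: "\<forall>x\<in>#T1. smooth p x"
    "witt_equiv (add_mset (p * u1) (add_mset (p * u2) ?R)) (add_mset (p * r1) (T1 + add_mset (p * u2) ?R))"
    using witt_equiv_residue_square[OF assms(1) su1 c1 b1 d1] by blast
  obtain T2 where T2: "\<forall>x\<in>#T2. smooth p x"
    "witt_equiv (add_mset (p * u2) (add_mset (p * r1) (T1 + ?R))) (add_mset (p * r2) (T2 + add_mset (p * r1) (T1 + ?R)))"
    using witt_equiv_residue_square[OF assms(1) su2 c2 b2 d2] by blast
  have "witt_equiv (?I X + M) (add_mset (p * r1) (T1 + add_mset (p * u2) ?R))"
    using T1(2) by (simp add: X1 X2)
  also have "witt_equiv \<dots> (add_mset (p * r1) (add_mset (p * r2) (T2 + T1 + ?R)))"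
    using T2(2) by (simp add: add_mset_commute ac_simps)
  finally have eq: "witt_equiv (?I X + M) (add_mset (p * r1) (add_mset (p * r2) (T2 + T1 + ?R)))" .
  show ?case
  proof (cases "r1 + r2 = 0")
    case True
    then have "p * r2 = - (p * r1)" by (metis add_eq_0_iff mult_minus_right)
    then have "witt_equiv (?I X + M) (T2 + T1 + ?R)"
      using eq witt_equiv_hyperbolic[of "p * r1" "T2 + T1 + ?R"] r1 p witt_equiv_trans by fastforce
    moreover have "?I X2 = image_mset ((*) p) (image_mset fst X2)"
      by (simp add: case_prod_unfold multiset.map_comp comp_def)
    ultimately have "witt_equiv (?I X + M) (image_mset ((*) p) (image_mset fst X2) + (T2 + T1 + M))"
      by (simp add: ac_simps)
    moreover have "\<forall>u\<in>#image_mset fst X2. smooth p u" using less.prems(1) by (auto simp: X1 X2)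
    ultimately show ?thesis using T1(1) T2(1)
      by (intro exI[of _ "image_mset fst X2"] exI[of _ "T2 + T1"]) (auto simp: X1 X2)
  next
    case False
    define s where "s = r1 + r2"
    have s: "s \<noteq> 0" "\<bar>s\<bar> < p" using False r1 r2 by (auto simp: s_def)
    have ss: "smooth p s" "smooth p r1" "smooth p r2" using s r1 r2 by (auto intro!: smooth_small)
    \<comment> \<open>After both coordinates are normalized to 1, the zero restricted to this plane
      is the vector (1, 1), the first vector of the new basis; hence the coordinates 1 and 0. The
      second entry has lost a factor p^2.\<close>
    define Y where "Y = add_mset (s, 1) (add_mset (r1 * r2 * s, 0) X2)"
    have sum: "p * r1 + p * r2 = p * s" by (simp add: s_def algebra_simps)
    have "witt_equiv (add_mset (p * r1) (add_mset (p * r2) (T2 + T1 + ?R)))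
        (add_mset (p * s) (add_mset (p * (r1 * r2 * s) * p\<^sup>2) (T2 + T1 + ?R)))"
      using witt_equiv_binary[of "p * r1" "p * r2" "T2 + T1 + ?R"] p s unfolding sum
      by (simp add: algebra_simps power2_eq_square)
    also have "witt_equiv \<dots> (add_mset (p * s) (add_mset (p * (r1 * r2 * s)) (T2 + T1 + ?R)))"
      using witt_equiv_square[of p "p * (r1 * r2 * s)" "add_mset (p * s) (T2 + T1 + ?R)"] p
      by (simp add: add_mset_commute)
    finally have eq2: "witt_equiv (?I X + M) (?I Y + (T2 + T1 + M))"
      using witt_equiv_trans[OF eq] by (simp add: Y_def ac_simps)
    have "\<forall>(u, c)\<in>#Y. smooth p u" using less.prems(1) ss by (auto simp: Y_def X1 X2)
    moreover have "p dvd (\<Sum>(u, c)\<in>#Y. u * c\<^sup>2)"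
    proof -
      have "(\<Sum>(u, c)\<in>#Y. u * c\<^sup>2) = (\<Sum>(u, c)\<in>#X. u * c\<^sup>2) - (u1 * c1\<^sup>2 - r1) - (u2 * c2\<^sup>2 - r2)"
        by (simp add: Y_def X1 X2 s_def)
      then show ?thesis using d1 d2 less.prems(2) by (metis dvd_diff)
    qed
    moreover have "\<exists>(u, c)\<in>#Y. \<not> p dvd c" using p by (auto simp: Y_def)
    moreover have "size (filter_mset (\<lambda>(u, c). \<not> p dvd c) Y) < size (filter_mset (\<lambda>(u, c). \<not> p dvd c) X)"
      using c1 c2 p by (simp add: Y_def X1 X2)
    ultimately obtain U T where UT: "size U < size Y" "\<forall>u\<in>#U. smooth p u" "\<forall>t\<in>#T. smooth p t"
      "witt_equiv (?I Y + (T2 + T1 + M)) (image_mset ((*) p) U + (T + (T2 + T1 + M)))"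
      using less.hyps[of Y "T2 + T1 + M"] by blast
    have "witt_equiv (?I X + M) (image_mset ((*) p) U + ((T + T2 + T1) + M))"
      using witt_equiv_trans[OF eq2 UT(4)] by (simp add: ac_simps)
    moreover have "size Y = size X" by (simp add: Y_def X1 X2)
    ultimately show ?thesis using UT T1(1) T2(1)
      by (intro exI[of _ U] exI[of _ "T + T2 + T1"]) auto
  qed
qed

subsection \<open>The residue form of a locally unimodular form is isotropic\<close>

text \<open>The neighbour of L at e consists of the vectors of L that pair integrally with e,
  together with integral multiples of e. It is its own dual because a vector integral on it becomes
  integral on L after subtracting a suitable integral multiple of e.\<close>

lemma self_dual_lattice_neighbour:
  assumes p: "prime p" and \<beta>: "sym_bilinear \<beta>" and sd: "self_dual_lattice p \<beta> L"
    and e: "\<beta> e e \<in> local_ring p"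
  shows "\<exists>L'. self_dual_lattice p \<beta> L' \<and> e \<in> L' \<and> (\<forall>g\<in>L. \<beta> g e \<in> local_ring p \<longrightarrow> g \<in> L')"
proof -
  have L: "\<And>v. v \<in> L \<longleftrightarrow> (\<forall>x\<in>L. \<beta> v x \<in> local_ring p)" "\<And>v. \<exists>k::nat. (\<lambda>i. of_int p ^ k * v i) \<in> L"
    using sd unfolding self_dual_lattice_def by blast+
  have L0: "(\<lambda>i. 0) \<in> L" using self_dual_lattice_zero[OF p \<beta> sd] .
  have b0: "\<beta> (\<lambda>i. 0) v = 0" for v
    using sym_bilinear_left[OF \<beta>, of v "-1" v v] by (simp add: lincomb_def)
  define L' where "L' = {lincomb y c e | y c. y \<in> L \<and> \<beta> y e \<in> local_ring p \<and> c \<in> local_ring p}"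
  have sub: "g \<in> L'" if "g \<in> L" "\<beta> g e \<in> local_ring p" for g
  proof -
    have "g = lincomb g 0 e" by (simp add: lincomb_def)
    then show ?thesis using that local_ring_0[OF p] unfolding L'_def by blast
  qed
  have eL: "e \<in> L'"
  proof -
    have "e = lincomb (\<lambda>i. 0) 1 e" by (simp add: lincomb_def)
    then show ?thesis using L0 b0 local_ring_0[OF p] local_ring_1[OF p] unfolding L'_def by fastforce
  qed
  have int: "\<beta> x y \<in> local_ring p" if xy: "x \<in> L'" "y \<in> L'" for x y
  proof -
    obtain x' c y' d where h: "x = lincomb x' c e" "x' \<in> L" "\<beta> x' e \<in> local_ring p" "c \<in> local_ring p"
      "y = lincomb y' d e" "y' \<in> L" "\<beta> y' e \<in> local_ring p" "d \<in> local_ring p"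
      using xy unfolding L'_def by blast
    have "\<beta> x' y' \<in> local_ring p" using L(1) h by blast
    then show ?thesis using h e p sym_bilinear_sym[OF \<beta>, of e y']
      by (simp add: sym_bilinear_left[OF \<beta>] sym_bilinear_right[OF \<beta>] local_ring_add local_ring_mult)
  qed
  have dual: "v \<in> L'" if v: "\<forall>x\<in>L'. \<beta> v x \<in> local_ring p" for v
  proof -
    have ve: "\<beta> v e \<in> local_ring p" using v eL by blast
    have "\<exists>c\<in>local_ring p. lincomb v (- c) e \<in> L"
    proof (cases "\<forall>x\<in>L. \<beta> x e \<in> local_ring p")
      case True
      then have "\<forall>x\<in>L. \<beta> v x \<in> local_ring p" using sub v by blast
      then have "v \<in> L" using L(1) by blast
      moreover have "lincomb v (- 0) e = v" by (simp add: lincomb_def)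
      ultimately show ?thesis using local_ring_0[OF p] by metis
    next
      case False
      then obtain x where x: "x \<in> L" "\<beta> x e \<notin> local_ring p" by blast
      then have "\<beta> x e \<noteq> 0" using local_ring_0[OF p] by metis
      then obtain w where w: "w \<in> L" "\<beta> w e \<noteq> 0" "\<forall>x\<in>L. \<beta> x e / \<beta> w e \<in> local_ring p"
        using self_dual_lattice_functional[OF p \<beta> sd x(1)] by blast
      have "\<beta> w e \<notin> local_ring p"
        using w(2) bspec[OF w(3) x(1)] local_ring_mult[OF p, of "\<beta> x e / \<beta> w e" "\<beta> w e"] x(2) by auto
      then have inv: "1 / \<beta> w e \<in> local_ring p" by (rule local_ring_inverse[OF p])
      have "lincomb (\<lambda>i. 0) (1 / \<beta> w e) w \<in> L" using self_dual_lattice_lincomb[OF p \<beta> sd L0 w(1) inv] .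
      then have "lincomb (\<lambda>i. 0) (1 / \<beta> w e) w \<in> L'" 
        using w(2) p by (intro sub) (auto simp: sym_bilinear_left[OF \<beta>] b0)
      then have "\<beta> v (lincomb (\<lambda>i. 0) (1 / \<beta> w e) w) \<in> local_ring p" using v by blast
      then have c: "\<beta> v w / \<beta> w e \<in> local_ring p"
        using b0[of v] sym_bilinear_sym[OF \<beta>, of v "\<lambda>i. 0"] by (simp add: sym_bilinear_right[OF \<beta>])
      \<comment> \<open>The coefficient makes the new vector orthogonal to w. Its pairing with x is
        thus that of v with x minus a multiple of w, where the multiple can be chosen to give a
        vector of L orthogonal to e, hence in \<open>L'\<close>.\<close>
      have "\<beta> (lincomb v (- (\<beta> v w / \<beta> w e)) e) x \<in> local_ring p" if x: "x \<in> L" for x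
      proof -
        have "lincomb x (- (\<beta> x e / \<beta> w e)) w \<in> L"
          using self_dual_lattice_lincomb[OF p \<beta> sd x w(1)] w(3) x local_ring_uminus[OF p] by blast
        then have "lincomb x (- (\<beta> x e / \<beta> w e)) w \<in> L'"
          using w(2) p by (intro sub) (auto simp: sym_bilinear_left[OF \<beta>])
        then have "\<beta> v (lincomb x (- (\<beta> x e / \<beta> w e)) w) \<in> local_ring p" using v by blast
        then show ?thesis using sym_bilinear_sym[OF \<beta>, of e x]
          by (simp add: sym_bilinear_left[OF \<beta>] sym_bilinear_right[OF \<beta>] mult.commute)
      qed
      then show ?thesis using c L(1) by blast
    qed
    then obtain c where c: "c \<in> local_ring p" "lincomb v (- c) e \<in> L" by blast
    moreover have "\<beta> (lincomb v (- c) e) e \<in> local_ring p"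
      using ve e c(1) p by (simp add: sym_bilinear_left[OF \<beta>] local_ring_diff local_ring_mult)
    moreover have "v = lincomb (lincomb v (- c) e) c e" by (simp add: lincomb_def)
    ultimately show ?thesis unfolding L'_def by blast
  qed
  have full: "\<exists>k::nat. (\<lambda>i. of_int p ^ k * v i) \<in> L'" for v
  proof -
    obtain k where k: "(\<lambda>i. of_int p ^ k * v i) \<in> L" using L(2) by blast
    obtain j where j: "of_int p ^ j * (of_int p ^ k * \<beta> v e) \<in> local_ring p"
      using ex_power_mult_local_ring[OF p] by blast
    have "lincomb (\<lambda>i. 0) (of_int p ^ j) (\<lambda>i. of_int p ^ k * v i) \<in> L"
      using self_dual_lattice_lincomb[OF p \<beta> sd L0 k] local_ring_power[OF p local_ring_of_int[OF p]] by blast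
    moreover have "\<beta> (\<lambda>i. of_int p ^ k * v i) e = of_int p ^ k * \<beta> v e"
      using sym_bilinear_scale[OF \<beta>, of e "of_int p ^ k" v] sym_bilinear_sym[OF \<beta>] by metis
    ultimately have "lincomb (\<lambda>i. 0) (of_int p ^ j) (\<lambda>i. of_int p ^ k * v i) \<in> L'"
      using j by (intro sub) (auto simp: sym_bilinear_left[OF \<beta>] b0)
    then show ?thesis by (intro exI[of _ "j + k"]) (simp add: lincomb_def power_add mult.assoc)
  qed
  show ?thesis using int dual full eL sub unfolding self_dual_lattice_def
    by (intro exI[of _ L']) blast
qed

lemma common_denominator:
  fixes n :: nat
  assumes p: "prime p" and "\<forall>i<n. c i \<in> local_ring p"
  shows "\<exists>d. \<not> p dvd d \<and> (\<forall>i<n. \<exists>z. of_int d * c i = of_int z)"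
  using assms(2)
proof (induction n)
  case 0
  then show ?case using p not_prime_unit by (intro exI[of _ 1]) auto
next
  case (Suc n)
  then obtain d where d: "\<not> p dvd d" "\<forall>i<n. \<exists>z. of_int d * c i = of_int z" by auto
  obtain a b where ab: "\<not> p dvd b" "c n = of_int a / of_int b"
    using Suc.prems[rule_format, of n] unfolding local_ring_def by blast
  then have "b \<noteq> 0" by auto
  have "\<exists>z. of_int (d * b) * c i = of_int z" if i: "i < Suc n" for i
  proof (cases "i = n")
    case True
    then show ?thesis using ab \<open>b \<noteq> 0\<close> by (intro exI[of _ "d * a"]) simp
  next
    case False
    then have "i < n" using i by simp
    then obtain z where "of_int d * c i = of_int z" using d by blast
    then have "of_int (d * b) * c i = of_int (z * b)" by (simp add: mult_ac) 
    then show ?thesis by blast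
  qed
  then show ?case using d(1) ab(1) p by (intro exI[of _ "d * b"]) (auto simp: prime_dvd_mult_iff)
qed

text \<open>A self-dual L containing the standard basis has integral coordinates at the entries from
  T and at most one p in the denominator at the entries pu. Some h in L is not integral at the
  latter, and integrality of its norm says that the numbers p h_i form a zero modulo p.\<close>

lemma residue_form_isotropic:
  assumes p: "prime p" and U: "U \<noteq> {#}" "\<forall>u\<in>#U. \<not> p dvd u" and T: "\<forall>t\<in>#T. \<not> p dvd t"
    and l: "mset l = image_mset ((*) p) U + T" and lu: "locally_unimodular p (diag_form l)"
  shows "\<exists>X. image_mset fst X = U \<and> p dvd (\<Sum>(u, c)\<in>#X. u * c\<^sup>2) \<and> (\<exists>(u, c)\<in>#X. \<not> p dvd c)"
proof -
  obtain us ts where us: "mset us = U" and ts: "mset ts = T" by (metis ex_mset)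
  define k where "k = map ((*) p) us @ ts"
  define n where "n = length us"
  have p0: "(of_int p :: rat) \<noteq> 0" using p by auto
  have "same_invariants l k" using l us ts by (intro same_invariants_perm) (simp add: k_def)
  then obtain L0 where L0: "self_dual_lattice p (diag_form k) L0"
    using lu p unfolding same_invariants_def locally_unimodular_def by blast
  let ?\<beta> = "diag_form k"
  note \<beta> = sym_bilinear_diag_form[of k]
  define e :: "nat \<Rightarrow> nat \<Rightarrow> rat" where "e i = (\<lambda>j. if j = i then 1 else 0)" for i
  have be: "?\<beta> x (e i) = of_int (k ! i) * x i" if "i < length k" for x i
    using that by (simp add: diag_form_def e_def if_distrib cong: if_cong)
  \<comment> \<open>Neighbours are taken at the basis vectors in turn; earlier ones survive because
    they pair integrally with the new one.\<close>
  have "\<exists>L. self_dual_lattice p ?\<beta> L \<and> (\<forall>i<m. e i \<in> L)" if "m \<le> length k" for m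
    using that
  proof (induction m)
    case 0 then show ?case using L0 by blast
  next
    case (Suc m)
    then obtain L where L: "self_dual_lattice p ?\<beta> L" "\<forall>i<m. e i \<in> L" by auto
    have "?\<beta> (e i) (e m) \<in> local_ring p" for i
      using Suc.prems p by (simp add: be) (simp add: e_def p)
    then show ?case using self_dual_lattice_neighbour[OF p \<beta> L(1), of "e m"] L(2)
      by (metis less_Suc_eq)
  qed
  then obtain L where sd: "self_dual_lattice p ?\<beta> L" and eL: "\<And>i. i < length k \<Longrightarrow> e i \<in> L"
    by (metis order_refl)
  have L: "\<And>v. v \<in> L \<longleftrightarrow> (\<forall>x\<in>L. ?\<beta> v x \<in> local_ring p)"
    using sd unfolding self_dual_lattice_def by blast+
  have ki: "k ! i = p * us ! i" "\<not> p dvd us ! i" if "i < n" for i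
    using that U us by (auto simp: k_def n_def nth_append)
  have kj: "\<not> p dvd k ! i" if "\<not> i < n" "i < length k" for i
    using that T ts by (auto simp: k_def n_def nth_append)
  have inv: "x \<in> local_ring p" if "of_int u * x \<in> local_ring p" "\<not> p dvd u" for u x
  proof -
    have "1 / of_int u \<in> local_ring p" using that(2) unfolding local_ring_def
      by (intro CollectI exI[of _ 1] exI[of _ u]) simp
    from local_ring_mult[OF p this that(1)] show ?thesis using that(2) by (auto split: if_splits)
  qed
  have coord: "of_int (k ! i) * x i \<in> local_ring p" if "x \<in> L" "i < length k" for x i
    using that L eL be by metis
  have n0: "0 < n" using U us by (auto simp: n_def)
  have nk: "n \<le> length k" by (simp add: n_def k_def)
  have "\<exists>h\<in>L. \<exists>i<n. h i \<notin> local_ring p"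
  proof (rule ccontr)
    assume *: "\<not> ?thesis"
    \<comment> \<open>Entry 0 is divisible by p. So if the first n coordinates were integral on L,
      the basis vector divided by p would pair integrally with L and lie in L, although its own
      coordinate 1/p is not integral.\<close>
    define g where "g = (\<lambda>j. (1 / of_int p) * e 0 j)"
    have "?\<beta> g x \<in> local_ring p" if x: "x \<in> L" for x
    proof -
      have "?\<beta> g x = 1 / of_int p * ?\<beta> x (e 0)"
        using sym_bilinear_scale[OF \<beta>] sym_bilinear_sym[OF \<beta>] unfolding g_def by metis
      also have "\<dots> = of_int (us ! 0) * x 0" using n0 nk p0 ki(1)[OF n0] be[of 0 x] by fastforce
      finally show ?thesis using * x n0 p by (auto intro: local_ring_mult)
    qed
    then have "g \<in> L" using L by blast
    then have "g 0 \<in> local_ring p" using * n0 by blast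
    then have "of_int 1 / of_int p \<in> local_ring p" by (simp add: g_def e_def)
    then have "p dvd 1" by (simp only: local_ring_of_int_divide_iff[OF p])
    then show False using p not_prime_unit by blast
  qed
  then obtain h i0 where h: "h \<in> L" and i0: "i0 < n" "h i0 \<notin> local_ring p" by blast
  have c: "of_int p * h i \<in> local_ring p" if "i < n" for i
    using inv[of "us ! i" "of_int p * h i"] coord[OF h, of i] ki[OF that] that nk by (simp add: mult_ac)
  then obtain d where d: "\<not> p dvd d" "\<forall>i<n. \<exists>z. of_int d * (of_int p * h i) = of_int z"
    using common_denominator[OF p, of n "\<lambda>i. of_int p * h i"] by blast
  then obtain z where z: "\<And>i. i < n \<Longrightarrow> of_int d * (of_int p * h i) = of_int (z i)" by metis
  have "?\<beta> h h \<in> local_ring p" using L h by blast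
  moreover have "{..<length k} = {..<n} \<union> {n..<length k}" using nk by auto
  then have "?\<beta> h h = (\<Sum>i<n. of_int (k ! i) * h i * h i) + (\<Sum>i=n..<length k. of_int (k ! i) * h i * h i)"
    unfolding diag_form_def by (simp add: sum.union_disjoint ivl_disj_int)
  moreover have "(\<Sum>i=n..<length k. of_int (k ! i) * h i * h i) \<in> local_ring p"
  proof (rule local_ring_sum[OF p])
    fix i assume "i \<in> {n..<length k}"
    then have "of_int (k ! i) * h i \<in> local_ring p" "\<not> p dvd k ! i" using coord[OF h] kj by auto
    then have "of_int (k ! i) * h i \<in> local_ring p" "h i \<in> local_ring p" using inv by blast+
    then show "of_int (k ! i) * h i * h i \<in> local_ring p" by (rule local_ring_mult[OF p])
  qed
  ultimately have "(\<Sum>i<n. of_int (k ! i) * h i * h i) \<in> local_ring p"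
    using local_ring_diff[OF p] by (metis add_diff_cancel_right')
  then have "of_int d * of_int d * (\<Sum>i<n. of_int (k ! i) * h i * h i) \<in> local_ring p"
    using p by (simp add: local_ring_mult)
  also have "of_int d * of_int d * (\<Sum>i<n. of_int (k ! i) * h i * h i) = of_int (\<Sum>i<n. us ! i * (z i)\<^sup>2) / of_int p"
  proof -
    have "of_int d * of_int d * (of_int (k ! i) * h i * h i) = of_int (us ! i * (z i)\<^sup>2) / of_int p" if "i < n" for i
    proof -
      have "of_int (us ! i * (z i)\<^sup>2) = of_int (us ! i) * (of_int d * (of_int p * h i))\<^sup>2"
        using z[OF that] by simp
      then show ?thesis using p0 ki[OF that] by (simp add: power2_eq_square field_simps) auto
    qed
    then show ?thesis by (simp add: sum_distrib_left sum_divide_distrib)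
  qed
  finally have pd: "p dvd (\<Sum>i<n. us ! i * (z i)\<^sup>2)" by (simp only: local_ring_of_int_divide_iff[OF p])
  have nz: "\<not> p dvd z i0"
  proof
    assume "p dvd z i0"
    then obtain w where "z i0 = p * w" by blast
    then have "of_int d * h i0 = of_int w" using z[OF i0(1)] p0 by simp
    then have "of_int d * h i0 \<in> local_ring p" using p by simp
    then show False using inv d(1) i0(2) by blast
  qed
  define X where "X = mset (map (\<lambda>i. (us ! i, z i)) [0..<n])"
  have "image_mset fst X = mset (map (\<lambda>i. us ! i) [0..<n])" by (simp add: X_def comp_def flip: mset_map)
  then have "image_mset fst X = U" by (simp add: n_def map_nth us)
  moreover have "(\<Sum>(u, c)\<in>#X. u * c\<^sup>2) = (\<Sum>i<n. us ! i * (z i)\<^sup>2)"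
    by (simp add: X_def sum_unfold_sum_mset lessThan_atLeast0 multiset.map_comp comp_def)
  moreover have "(us ! i0, z i0) \<in># X" using i0(1) by (auto simp: X_def)
  ultimately show ?thesis using pd nz by (intro exI[of _ X]) auto
qed

subsection \<open>Reduction to entries plus or minus one\<close>

definition all_locally_unimodular :: "int multiset \<Rightarrow> bool" where
  "all_locally_unimodular M \<longleftrightarrow> (\<forall>l p. mset l = M \<longrightarrow> prime p \<longrightarrow> locally_unimodular p (diag_form l))"

lemma all_locally_unimodular_witt_equiv:
  assumes "witt_equiv M N" "all_locally_unimodular M" shows "all_locally_unimodular N"
proof -
  obtain l where l: "mset l = M" by (metis ex_mset)
  show ?thesis unfolding all_locally_unimodular_def
  proof (intro allI impI)
    fix l' and p :: int assume l': "mset l' = N" and p: "prime p"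
    have "same_invariants l l'" using assms(1) l l' unfolding witt_equiv_def by blast
    then show "locally_unimodular p (diag_form l')"
      using assms(2) l p unfolding same_invariants_def all_locally_unimodular_def by blast
  qed
qed

lemma witt_definite_witt_equiv:
  assumes "witt_equiv M N" "\<forall>l. mset l = N \<longrightarrow> witt_definite s (diag_form l)" "mset l = M"
  shows "witt_definite s (diag_form l)"
proof -
  obtain l' where l': "mset l' = N" by (metis ex_mset)
  then have "same_invariants l l'" using assms(1,3) unfolding witt_equiv_def by blast
  then show ?thesis using assms(2) l' unfolding same_invariants_def by blast
qed

text \<open>Local unimodularity passes to the new form, so the residue form has a zero again, and
  each zero lowers the number of entries divisible by p.\<close>

lemma eliminate_prime:
  assumes "prime p" "\<forall>u\<in>#U. smooth p u" "\<forall>t\<in>#T. smooth p t"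
    "all_locally_unimodular (image_mset ((*) p) U + T)"
  shows "\<exists>N. (\<forall>x\<in>#N. smooth p x) \<and> witt_equiv (image_mset ((*) p) U + T) N"
  using assms(2-4)
proof (induction "size U" arbitrary: U T rule: less_induct)
  case less
  show ?case
  proof (cases "U = {#}")
    case True
    then show ?thesis using less.prems by (intro exI[of _ T]) auto
  next
    case False
    obtain l where l: "mset l = image_mset ((*) p) U + T" by (metis ex_mset)
    obtain X where X: "image_mset fst X = U" "p dvd (\<Sum>(u, c)\<in>#X. u * c\<^sup>2)" "\<exists>(u, c)\<in>#X. \<not> p dvd c"
    proof -
      have "locally_unimodular p (diag_form l)"
        using less.prems(3) l assms(1) unfolding all_locally_unimodular_def by blast
      moreover have "\<forall>u\<in>#U. \<not> p dvd u" "\<forall>t\<in>#T. \<not> p dvd t"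
        using less.prems(1,2) smooth_not_dvd[OF _ assms(1)] by blast+
      ultimately show ?thesis using that residue_form_isotropic[OF assms(1) False _ _ l] by blast
    qed
    have "\<forall>(u, c)\<in>#X. smooth p u" using less.prems(1) unfolding X(1)[symmetric] by force
    then obtain U' T' where U': "size U' < size X" "\<forall>u\<in>#U'. smooth p u" "\<forall>t\<in>#T'. smooth p t"
      "witt_equiv (image_mset (\<lambda>(u, c). p * u) X + T) (image_mset ((*) p) U' + (T' + T))"
      using witt_equiv_isotropic_residue[OF assms(1) _ X(2,3)] by blast
    have "image_mset (\<lambda>(u, c). p * u) X = image_mset ((*) p) U"
      unfolding X(1)[symmetric] by (simp add: case_prod_unfold multiset.map_comp comp_def)
    then have eq: "witt_equiv (image_mset ((*) p) U + T) (image_mset ((*) p) U' + (T' + T))"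
      using U'(4) by simp
    have "size U' < size U" using U'(1) X(1) by (metis size_image_mset)
    moreover have "\<forall>t\<in>#T' + T. smooth p t" using U'(3) less.prems(2) by auto
    ultimately obtain N where "\<forall>x\<in>#N. smooth p x" "witt_equiv (image_mset ((*) p) U' + (T' + T)) N"
      using less.hyps U'(2) all_locally_unimodular_witt_equiv[OF eq less.prems(3)] by blast
    then show ?thesis using witt_equiv_trans[OF eq] by blast
  qed
qed

text \<open>Even powers of p are squares and vanish, odd powers leave one factor p. The context
  \<open>N\<close> holds the entries already treated during the induction.\<close>

lemma witt_equiv_split_prime:
  assumes p: "prime p" and "\<forall>x\<in>#M. smooth (p + 1) x"
  shows "\<exists>U T. (\<forall>u\<in>#U. smooth p u) \<and> (\<forall>t\<in>#T. smooth p t) \<and>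
    (\<forall>N. witt_equiv (M + N) (image_mset ((*) p) U + T + N))"
  using assms(2)
proof (induction M)
  case empty
  then show ?case by (intro exI[of _ "{#}"]) auto
next
  case (add x M)
  then obtain U T where UT: "\<forall>u\<in>#U. smooth p u" "\<forall>t\<in>#T. smooth p t"
    "\<And>N. witt_equiv (M + N) (image_mset ((*) p) U + T + N)" by auto
  have sx: "smooth (p + 1) x" using add.prems by simp
  then have "x \<noteq> 0" by (simp add: smooth_def)
  then obtain m where m: "x = p ^ multiplicity p x * m" "\<not> p dvd m"
    using multiplicity_decompose'[of x p] p not_prime_unit by metis
  have sm: "smooth p m"
    unfolding smooth_def
  proof (intro conjI allI impI)
    show "m \<noteq> 0" using m \<open>x \<noteq> 0\<close> by auto
    fix q assume q: "prime q" "q dvd m"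
    then have "q dvd x" using m(1) by (metis dvd_mult)
    then have "q \<le> p" using sx q unfolding smooth_def by force
    then show "q < p" using q m(2) by (cases "q = p") auto
  qed
  define v where "v = multiplicity p x"
  have pw: "p ^ (v div 2) \<noteq> 0" using p by auto
  show ?case
  proof (cases "even v")
    case True
    then have "p ^ v = (p ^ (v div 2))\<^sup>2" by (metis power_mult dvd_div_mult_self)
    then have x: "x = m * (p ^ (v div 2))\<^sup>2" using m(1) v_def by (metis mult.commute)
    have "witt_equiv (add_mset x M + N) (image_mset ((*) p) U + add_mset m T + N)" for N
      using witt_equiv_trans[OF witt_equiv_square[OF pw, of m "M + N"] ] UT(3)[of "add_mset m N"] x
      by simp
    then show ?thesis using UT sm by (intro exI[of _ U] exI[of _ "add_mset m T"]) auto
  next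
    case False
    then have "p ^ v = p * (p ^ (v div 2))\<^sup>2"
      by (metis odd_two_times_div_two_succ power_Suc power_mult mult.commute Suc_eq_plus1)
    then have x: "x = p * m * (p ^ (v div 2))\<^sup>2" using m(1) v_def by (metis mult.commute mult.left_commute)
    have "witt_equiv (add_mset x M + N) (image_mset ((*) p) (add_mset m U) + T + N)" for N
      using witt_equiv_trans[OF witt_equiv_square[OF pw, of "p * m" "M + N"] ] UT(3)[of "add_mset (p * m) N"] x
      by simp
    then show ?thesis using UT sm by (intro exI[of _ "add_mset m U"] exI[of _ T]) auto
  qed
qed

lemma witt_equiv_units:
  assumes "\<forall>x\<in>#M. smooth (int P) x" "all_locally_unimodular M"
  shows "\<exists>N. (\<forall>x\<in>#N. x = 1 \<or> x = -1) \<and> witt_equiv M N"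
  using assms
proof (induction P arbitrary: M)
  case 0
  have "x = 1 \<or> x = -1" if "x \<in># M" for x
  proof (rule ccontr)
    assume "\<not> ?thesis"
    then have "\<bar>x\<bar> \<noteq> 1" by linarith
    then obtain q where q: "prime q" "q dvd x" using prime_factor_int by blast
    have "smooth 0 x" using 0(1) that by simp
    then have "q < 0" using q unfolding smooth_def by blast
    then show False using prime_gt_0_int[OF q(1)] by linarith
  qed
  then show ?case by (intro exI[of _ M]) auto
next
  case (Suc P)
  show ?case
  proof (cases "prime (int P)")
    case True
    have "\<forall>x\<in>#M. smooth (int P + 1) x" using Suc.prems(1) by (simp add: add.commute)
    then obtain U T where UT: "\<forall>u\<in>#U. smooth (int P) u" "\<forall>t\<in>#T. smooth (int P) t"
      "\<forall>N. witt_equiv (M + N) (image_mset ((*) (int P)) U + T + N)"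
      using witt_equiv_split_prime[OF True] by blast
    have eq: "witt_equiv M (image_mset ((*) (int P)) U + T)" using UT(3)[rule_format, of "{#}"] by simp
    from eliminate_prime[OF True UT(1,2) all_locally_unimodular_witt_equiv[OF eq Suc.prems(2)]]
    obtain N where N: "\<forall>x\<in>#N. smooth (int P) x" "witt_equiv (image_mset ((*) (int P)) U + T) N" by blast
    note eq2 = witt_equiv_trans[OF eq N(2)]
    show ?thesis
      using Suc.IH[OF N(1) all_locally_unimodular_witt_equiv[OF eq2 Suc.prems(2)]] witt_equiv_trans[OF eq2]
      by blast
  next
    case False
    have "\<forall>x\<in>#M. smooth (int P) x"
    proof
      fix x assume "x \<in># M"
      then have "smooth (int (Suc P)) x" using Suc.prems by blast
      then have "x \<noteq> 0" and *: "\<And>q. prime q \<Longrightarrow> q dvd x \<Longrightarrow> q < int (Suc P)"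
        unfolding smooth_def by blast+
      have "q < int P" if "prime q" "q dvd x" for q
        using *[OF that] that(1) False by (cases "q = int P") auto
      then show "smooth (int P) x" using \<open>x \<noteq> 0\<close> unfolding smooth_def by blast
    qed
    then show ?thesis using Suc by blast
  qed
qed

text \<open>The form is definite modulo its radical, which serves as \<open>L\<close>.\<close>

lemma witt_definite_same_sign:
  assumes "\<forall>x\<in>set l. x = s" "s = 1 \<or> s = -1"
  shows "witt_definite (of_int s) (diag_form l)"
proof -
  define L where "L = {x :: nat \<Rightarrow> rat. \<forall>i<length l. x i = 0}"
  have "of_int s * diag_form l v v > 0" if v: "v \<notin> L" for v
  proof -
    have "of_int s * diag_form l v v = (\<Sum>i<length l. (v i)\<^sup>2)"
      unfolding diag_form_def sum_distrib_left
    proof (rule sum.cong)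
      fix i assume "i \<in> {..<length l}"
      then have "l ! i = s" using assms(1) by simp
      then show "of_int s * (of_int (l ! i) * v i * v i) = (v i)\<^sup>2"
        using assms(2) by (auto simp: power2_eq_square)
    qed simp
    moreover obtain i where "i < length l" "v i \<noteq> 0" using v by (auto simp: L_def)
    then have "(\<Sum>i<length l. (v i)\<^sup>2) > 0" by (intro sum_pos2[of _ i]) auto
    ultimately show ?thesis by simp
  qed
  moreover have "(\<lambda>i. 0) \<in> L" by (simp add: L_def)
  ultimately show ?thesis unfolding witt_definite_def
    by (intro exI[of _ L]) (auto simp: L_def lincomb_def diag_form_def)
qed

lemma witt_definite_units:
  assumes "\<forall>x\<in>#N. x = 1 \<or> x = -1"
  shows "\<exists>s. (s = 1 \<or> s = -1) \<and> (\<forall>l. mset l = N \<longrightarrow> witt_definite (of_int s) (diag_form l))"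
  using assms
proof (induction "size N" arbitrary: N rule: less_induct)
  case less
  show ?case
  proof (cases "1 \<in># N \<and> - 1 \<in># N")
    case True
    then obtain N' where "N = add_mset 1 N'" by (metis insert_DiffM)
    then obtain K where N: "N = add_mset 1 (add_mset (- 1) K)" using True
      by (metis insert_DiffM insert_noteq_member one_neq_neg_one)
    then obtain s where "s = 1 \<or> s = -1" "\<forall>l. mset l = K \<longrightarrow> witt_definite (of_int s) (diag_form l)"
      using less.hyps[of K] less.prems by auto
    moreover have "witt_equiv N K" using witt_equiv_hyperbolic[of 1 K] N by simp
    ultimately show ?thesis using witt_definite_witt_equiv[of N K] by blast
  next
    case False
    have "\<exists>s. (s = 1 \<or> s = -1) \<and> (\<forall>x\<in>#N. x = s)"
    proof (cases "1 \<in># N")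
      case True
      then have "\<forall>x\<in>#N. x = 1" using False less.prems by metis
      then show ?thesis by blast
    next
      case notin: False
      then have "\<forall>x\<in>#N. x = -1" using less.prems by metis
      then show ?thesis by blast
    qed
    then obtain s where s: "s = 1 \<or> s = -1" "\<forall>x\<in>#N. x = s" by blast
    have "witt_definite (of_int s) (diag_form l)" if "mset l = N" for l
      using s that by (intro witt_definite_same_sign) auto
    then show ?thesis using s(1) by blast
  qed
qed

lemma witt_definite_of_locally_unimodular:
  assumes "\<forall>x\<in>set l. x \<noteq> 0" "\<forall>p. prime p \<longrightarrow> locally_unimodular p (diag_form l)"
  shows "\<exists>s. (s = 1 \<or> s = -1) \<and> witt_definite (of_int s) (diag_form l)"
proof -
  have "\<exists>P. \<forall>x\<in>set l. smooth (int P) x"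
  proof -
    define P where "P = nat (\<Sum>x\<in>set l. \<bar>x\<bar>) + 1"
    have "\<bar>x\<bar> \<le> (\<Sum>x\<in>set l. \<bar>x\<bar>)" if "x \<in> set l" for x
      using that by (intro member_le_sum) auto
    then have "\<bar>x\<bar> < int P" if "x \<in> set l" for x using that unfolding P_def by fastforce
    then show ?thesis using assms(1) smooth_small by blast
  qed
  then obtain P where "\<forall>x\<in>#mset l. smooth (int P) x" by auto
  moreover have "all_locally_unimodular (mset l)"
    using assms(2) same_invariants_perm unfolding all_locally_unimodular_def same_invariants_def by blast
  ultimately obtain N where N: "\<forall>x\<in>#N. x = 1 \<or> x = -1" "witt_equiv (mset l) N" using witt_equiv_units by blast
  then show ?thesis using witt_definite_units[OF N(1)] witt_definite_witt_equiv[OF N(2)] by blast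
qed

section \<open>Indefinite unimodular lattices are isotropic\<close>

text \<open>Cramer's rule over the rationals gives the solution, and it is integral because the
  denominator det G is 1 or -1.\<close>

lemma unimodular_dual_basis:
  fixes G :: "int^'n^'n"
  assumes "unimodular G"
  shows "\<exists>g. G *v g = axis i 1"
proof -
  define A :: "rat^'n^'n" where "A = (\<chi> a b. of_int (G $ a $ b))"
  define d where "d k = det (\<chi> a b. if b = k then axis i 1 $ a else G $ a $ b)" for k
  have of_det: "det (\<chi> a b. of_int (M $ a $ b)) = (of_int (det M) :: rat)" for M :: "int^'n^'n"
    by (simp add: det_def)
  have dA: "det A = of_int (det G)" unfolding A_def by (rule of_det)
  have unit: "det G * det G = 1" using assms by (auto simp: unimodular_def)
  then have "det A \<noteq> 0" unfolding dA by auto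
  define x where "x = (\<chi> k. det (\<chi> a b. if b = k then axis i 1 $ a else A $ a $ b) / det A)"
  have Ax: "A *v x = axis i 1" using cramer[OF \<open>det A \<noteq> 0\<close>, of x "axis i 1"] by (simp add: x_def)
  have xk: "x $ k = of_int (d k * det G)" for k
  proof -
    have "(\<chi> a b. if b = k then axis i 1 $ a else A $ a $ b) =
        (\<chi> a b. of_int ((\<chi> a b. if b = k then axis i 1 $ a else G $ a $ b) $ a $ b))"
      by (simp add: vec_eq_iff A_def axis_def)
    then have "det (\<chi> a b. if b = k then axis i 1 $ a else A $ a $ b) = of_int (d k)"
      unfolding d_def by (simp only: of_det)
    moreover have "1 / of_int (det G) = (of_int (det G) :: rat)"
      using assms by (auto simp: unimodular_def)
    ultimately show ?thesis by (simp add: x_def dA divide_inverse)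
  qed
  have "(G *v (\<chi> k. d k * det G)) $ a = axis i 1 $ a" for a
  proof -
    have "of_int ((G *v (\<chi> k. d k * det G)) $ a) = (A *v x) $ a"
      by (simp add: matrix_vector_mult_def A_def xk)
    also have "\<dots> = of_int (axis i 1 $ a)" unfolding Ax by (simp add: axis_def)
    finally show ?thesis by (simp only: of_int_eq_iff)
  qed
  then show ?thesis by (intro exI[of _ "\<chi> k. d k * det G"]) (simp add: vec_eq_iff)
qed

lemma bil_eq_matrix_vector: "bil G x y = (\<Sum>i\<in>UNIV. x $ i * (G *v y) $ i)"
  by (simp add: bil_def matrix_vector_mult_def sum_distrib_left mult.assoc)

lemma unimodular_coordinate:
  assumes "unimodular G" shows "\<exists>g. \<forall>x. bil G x g = x $ i"
proof -
  obtain g where "G *v g = axis i 1" using unimodular_dual_basis[OF assms] by blast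
  then show ?thesis by (intro exI[of _ g]) (simp add: bil_eq_matrix_vector axis_def if_distrib cong: if_cong)
qed

section \<open>The rational span of the lattice and its diagonalization\<close>

definition rat_bil :: "int^'n^'n \<Rightarrow> rat^'n \<Rightarrow> rat^'n \<Rightarrow> rat" where
  "rat_bil G x y = (\<Sum>i\<in>UNIV. \<Sum>j\<in>UNIV. x $ i * of_int (G $ i $ j) * y $ j)"

definition rat_vec :: "int^'n \<Rightarrow> rat^'n" where
  "rat_vec x = (\<chi> i. of_int (x $ i))"

lemma rat_bil_add_left: "rat_bil G (x + y) z = rat_bil G x z + rat_bil G y z"
  by (simp add: rat_bil_def algebra_simps sum.distrib)

lemma rat_bil_scale_left: "rat_bil G (c *s x) z = c * rat_bil G x z"
  by (simp add: rat_bil_def algebra_simps sum_distrib_left)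

lemma rat_bil_add_right: "rat_bil G z (x + y) = rat_bil G z x + rat_bil G z y"
  by (simp add: rat_bil_def algebra_simps sum.distrib)

lemma rat_bil_scale_right: "rat_bil G z (c *s x) = c * rat_bil G z x"
  by (simp add: rat_bil_def algebra_simps sum_distrib_left)

lemma rat_bil_zero: "rat_bil G 0 z = 0" "rat_bil G z 0 = 0"
  by (simp_all add: rat_bil_def)

lemma rat_bil_sum_left: "rat_bil G (\<Sum>a\<in>S. f a) z = (\<Sum>a\<in>S. rat_bil G (f a) z)"
  by (induction S rule: infinite_finite_induct) (simp_all add: rat_bil_zero rat_bil_add_left)

lemma rat_bil_sum_right: "rat_bil G z (\<Sum>a\<in>S. f a) = (\<Sum>a\<in>S. rat_bil G z (f a))"
  by (induction S rule: infinite_finite_induct) (simp_all add: rat_bil_zero rat_bil_add_right)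

lemma rat_bil_sym:
  assumes "symmetric_gram G" shows "rat_bil G x y = rat_bil G y x"
proof -
  have "rat_bil G x y = (\<Sum>j\<in>UNIV. \<Sum>i\<in>UNIV. x $ i * of_int (G $ i $ j) * y $ j)"
    unfolding rat_bil_def by (rule sum.swap)
  also have "\<dots> = rat_bil G y x" unfolding rat_bil_def using assms
    by (intro sum.cong) (auto simp: symmetric_gram_def mult_ac)
  finally show ?thesis .
qed

lemma rat_bil_rat_vec: "rat_bil G (rat_vec x) (rat_vec y) = of_int (bil G x y)"
  by (simp add: rat_bil_def rat_vec_def bil_def)

lemma rat_bil_coordinate:
  assumes "unimodular G" shows "\<exists>g. \<forall>x. rat_bil G x (rat_vec g) = x $ i"
proof -
  obtain g where g: "G *v g = axis i 1" using unimodular_dual_basis[OF assms] by blast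
  have "(\<Sum>j\<in>UNIV. of_int (G $ a $ j) * of_int (g $ j)) = (of_int ((G *v g) $ a) :: rat)" for a
    by (simp add: matrix_vector_mult_def)
  then have "rat_bil G x (rat_vec g) = (\<Sum>a\<in>UNIV. x $ a * of_int ((G *v g) $ a))" for x
    by (simp add: rat_bil_def rat_vec_def mult.assoc flip: sum_distrib_left)
  then have "rat_bil G x (rat_vec g) = x $ i" for x
    unfolding g by (simp add: axis_def if_distrib cong: if_cong)
  then show ?thesis by blast
qed

text \<open>Norms are nonzero integers because they become the entries of a
  \<open>diag_form\<close>; rescaling the vectors achieves this.\<close>

definition orthogonal_system :: "int^'n^'n \<Rightarrow> (rat^'n) set \<Rightarrow> bool" where
  "orthogonal_system G S \<longleftrightarrow> finite S \<and> (\<forall>v\<in>S. \<exists>a. a \<noteq> 0 \<and> rat_bil G v v = of_int a) \<and>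
     (\<forall>v\<in>S. \<forall>w\<in>S. v \<noteq> w \<longrightarrow> rat_bil G v w = 0)"

lemma orthogonal_system_card:
  fixes G :: "int^'n^'n"
  assumes "orthogonal_system G S" shows "card S \<le> vec.dim (UNIV :: (rat^'n) set)"
proof -
  have fin: "finite S" using assms by (simp add: orthogonal_system_def)
  have "u w = 0" if "(\<Sum>v\<in>S. u v *s v) = 0" "w \<in> S" for u w
  proof -
    have "0 = rat_bil G (\<Sum>v\<in>S. u v *s v) w" using that by (simp add: rat_bil_zero)
    also have "\<dots> = (\<Sum>v\<in>S. u v * rat_bil G v w)" by (simp add: rat_bil_sum_left rat_bil_scale_left)
    also have "\<dots> = (\<Sum>v\<in>S. if v = w then u w * rat_bil G w w else 0)"
      using assms that by (intro sum.cong) (auto simp: orthogonal_system_def)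
    also have "\<dots> = u w * rat_bil G w w" using fin that by simp
    finally show ?thesis using assms that(2) by (auto simp: orthogonal_system_def)
  qed
  then have "vec.independent S" using fin by (auto simp: vec.dependent_finite)
  then show ?thesis by (intro vec.independent_card_le_dim) auto
qed

lemma ex_integer_square_multiple:
  assumes "(r::rat) \<noteq> 0" shows "\<exists>c a. c \<noteq> 0 \<and> a \<noteq> 0 \<and> c * c * r = of_int a"
proof -
  obtain a b where ab: "r = of_int a / of_int b" "b > 0"
    by (metis Fract_of_int_quotient Rat_cases)
  then have "of_int b * of_int b * r = of_int (a * b)" "a \<noteq> 0" using assms by auto
  then show ?thesis using ab(2) by (intro exI[of _ "of_int b"] exI[of _ "a * b"]) auto
qed

text \<open>A maximal orthogonal system S spans. A vector orthogonal to S is isotropic, since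
  otherwise a multiple of it would enlarge S; by polarization the form vanishes on the complement of
  S, which therefore lies in the radical and is zero by unimodularity. The map f reads the first
  terms of a sequence as coordinates in the basis S.\<close>

lemma ex_diagonalization:
  fixes G :: "int^'n^'n"
  assumes sym: "symmetric_gram G" and uni: "unimodular G"
  shows "\<exists>l f. (\<forall>x\<in>set l. x \<noteq> 0) \<and> surj f \<and> (\<forall>x c y. f (lincomb x c y) = f x + c *s f y) \<and>
    (\<forall>x y. rat_bil G (f x) (f y) = diag_form l x y)"
proof -
  have "orthogonal_system G {}" by (simp add: orthogonal_system_def)
  then obtain S where S: "orthogonal_system G S" and max: "\<And>S'. orthogonal_system G S' \<Longrightarrow> card S' \<le> card S"
    using ex_has_greatest_nat[of "orthogonal_system G" "{}" card "Suc (vec.dim (UNIV :: (rat^'n) set))"]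
      orthogonal_system_card[of G] by (auto simp: less_Suc_eq_le)
  have fin: "finite S" using S by (simp add: orthogonal_system_def)
  have orth: "rat_bil G v w = 0" if "v \<in> S" "w \<in> S" "v \<noteq> w" for v w
    using S that by (auto simp: orthogonal_system_def)
  obtain q where q: "\<And>v. v \<in> S \<Longrightarrow> q v \<noteq> 0 \<and> rat_bil G v v = of_int (q v)"
    using S unfolding orthogonal_system_def by metis
  define perp where "perp u \<longleftrightarrow> (\<forall>v\<in>S. rat_bil G u v = 0)" for u
  have iso: "rat_bil G u u = 0" if u: "perp u" for u
  proof (rule ccontr)
    assume "rat_bil G u u \<noteq> 0"
    then obtain c a where ca: "c \<noteq> 0" "a \<noteq> 0" "c * c * rat_bil G u u = of_int a"
      using ex_integer_square_multiple by blast
    have qu: "rat_bil G (c *s u) (c *s u) = of_int a"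
      using ca(3) by (simp add: rat_bil_scale_left rat_bil_scale_right mult.assoc)
    have pu: "rat_bil G (c *s u) v = 0" "rat_bil G v (c *s u) = 0" if "v \<in> S" for v
      using u that rat_bil_sym[OF sym] by (auto simp: perp_def rat_bil_scale_left rat_bil_scale_right)
    have "c *s u \<notin> S" using pu(1)[of "c *s u"] qu ca(2) by auto
    moreover have "orthogonal_system G (insert (c *s u) S)"
      using S qu ca(2) pu unfolding orthogonal_system_def by auto
    ultimately show False using max[of "insert (c *s u) S"] fin by simp
  qed
  have perp0: "u = 0" if u: "perp u" for u
  proof -
    have cross: "rat_bil G u w = 0" if w: "perp w" for w
    proof -
      have "perp (u + w)" using u w by (simp add: perp_def rat_bil_add_left)
      from iso[OF this] iso[OF u] iso[OF w] rat_bil_sym[OF sym, of w u]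
      show ?thesis by (simp add: rat_bil_add_left rat_bil_add_right)
    qed
    have "rat_bil G u w = 0" for w
    proof -
      define w' where "w' = w - (\<Sum>v\<in>S. (rat_bil G w v / of_int (q v)) *s v)"
      have w: "w = w' + (\<Sum>v\<in>S. (rat_bil G w v / of_int (q v)) *s v)" by (simp add: w'_def)
      have "rat_bil G w' x = 0" if x: "x \<in> S" for x
      proof -
        have "rat_bil G w x = rat_bil G w' x + (\<Sum>v\<in>S. rat_bil G w v / of_int (q v) * rat_bil G v x)"
          by (subst w) (simp add: rat_bil_add_left rat_bil_sum_left rat_bil_scale_left)
        also have "(\<Sum>v\<in>S. rat_bil G w v / of_int (q v) * rat_bil G v x) = (\<Sum>v\<in>S. if v = x then rat_bil G w x else 0)"
          using q orth x by (intro sum.cong) auto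
        finally show ?thesis using fin x by simp
      qed
      then have "rat_bil G u w' = 0" by (intro cross) (simp add: perp_def)
      moreover have "rat_bil G u w = rat_bil G u w' + (\<Sum>v\<in>S. rat_bil G w v / of_int (q v) * rat_bil G u v)"
        by (subst w) (simp add: rat_bil_add_right rat_bil_sum_right rat_bil_scale_right)
      ultimately show ?thesis using u by (simp add: perp_def)
    qed
    then have "u $ i = 0" for i using rat_bil_coordinate[OF uni, of i] by metis
    then show ?thesis by (simp add: vec_eq_iff)
  qed
  obtain vs where vs: "set vs = S" "distinct vs" using finite_distinct_list[OF fin] by blast
  define n where "n = length vs"
  define l where "l = map q vs"
  define f where "f x = (\<Sum>i<n. x i *s vs ! i)" for x :: "nat \<Rightarrow> rat"
  have vsS: "vs ! i \<in> S" if "i < n" for i using that vs(1) by (auto simp: n_def)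
  have B: "rat_bil G (vs ! i) (vs ! j) = (if i = j then of_int (q (vs ! i)) else 0)" if "i < n" "j < n" for i j
    using that vs(2) vsS q orth by (auto simp: n_def nth_eq_iff_index_eq)
  have pair: "rat_bil G (f x) (vs ! j) = x j * of_int (q (vs ! j))" if "j < n" for x j
  proof -
    have "rat_bil G (f x) (vs ! j) = (\<Sum>i<n. x i * rat_bil G (vs ! i) (vs ! j))"
      by (simp add: f_def rat_bil_sum_left rat_bil_scale_left)
    also have "\<dots> = (\<Sum>i<n. if i = j then x j * of_int (q (vs ! j)) else 0)"
      using that B by (intro sum.cong) auto
    finally show ?thesis using that by simp
  qed
  have "rat_bil G (f x) (f y) = diag_form l x y" for x y
  proof -
    have "rat_bil G (f x) (f y) = (\<Sum>j<n. y j * rat_bil G (f x) (vs ! j))"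
      by (simp add: f_def[of y] rat_bil_sum_right rat_bil_scale_right)
    also have "\<dots> = (\<Sum>j<n. of_int (q (vs ! j)) * x j * y j)"
      using pair by (intro sum.cong) (auto simp: mult_ac)
    finally show ?thesis by (simp add: diag_form_def l_def n_def)
  qed
  moreover have "f (lincomb x c y) = f x + c *s f y" for x c y
    by (simp add: f_def lincomb_def vec.scale_left_distrib sum.distrib vec.scale_sum_right)
  moreover have "surj f"
    unfolding surj_def
  proof
    fix w
    define x where "x = (\<lambda>i. rat_bil G w (vs ! i) / of_int (q (vs ! i)))"
    have "rat_bil G (w - f x) v = 0" if v: "v \<in> S" for v
    proof -
      obtain j where j: "j < n" "v = vs ! j" using v vs(1) by (metis in_set_conv_nth n_def)
      have "rat_bil G w v = rat_bil G (w - f x) v + rat_bil G (f x) v"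
        by (simp flip: rat_bil_add_left)
      moreover have "rat_bil G (f x) v = rat_bil G w v"
        unfolding j(2) pair[OF j(1)] using q[OF vsS[OF j(1)]] by (simp add: x_def)
      ultimately show ?thesis by simp
    qed
    then have "w - f x = 0" by (intro perp0) (simp add: perp_def)
    then show "\<exists>x. w = f x" by (intro exI[of _ x]) simp
  qed
  moreover have "\<forall>x\<in>set l. x \<noteq> 0" using q vs(1) by (auto simp: l_def)
  ultimately show ?thesis by blast
qed

lemma ex_integer_multiple:
  fixes x :: "rat^'n"
  shows "\<exists>d y. d \<noteq> 0 \<and> rat_vec y = of_int d *s x"
proof -
  define b where "b i = snd (quotient_of (x $ i))" for i
  define a where "a i = fst (quotient_of (x $ i))" for i
  have b: "b i > 0" for i unfolding b_def by (metis quotient_of_denom_pos prod.collapse)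
  have x: "x $ i = of_int (a i) / of_int (b i)" for i unfolding a_def b_def
    by (metis quotient_of_div prod.collapse)
  define d where "d = (\<Prod>i\<in>UNIV. b i)"
  have "of_int d * x $ i = of_int (a i * (\<Prod>j\<in>UNIV - {i}. b j))" for i
  proof -
    have "d = b i * (\<Prod>j\<in>UNIV - {i}. b j)" unfolding d_def by (simp add: prod.remove)
    then show ?thesis using b[of i] by (simp add: x)
  qed
  then have "rat_vec (\<chi> i. a i * (\<Prod>j\<in>UNIV - {i}. b j)) = of_int d *s x"
    by (simp add: vec_eq_iff rat_vec_def)
  moreover have "d \<noteq> 0" using b unfolding d_def by (simp add: less_imp_neq[symmetric])
  ultimately show ?thesis by blast
qed

text \<open>By unimodularity the p-integral vectors form a self-dual lattice for every p, so the
  form is definite up to a totally isotropic \<open>L\<close>. Without a nonzero isotropic vector, f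
  would map \<open>L\<close> to 0; a vector of the opposite sign would then be orthogonal to
  \<open>L\<close> and contradict definiteness.\<close>

lemma indefinite_unimodular_isotropic:
  fixes G :: "int^'n^'n"
  assumes sym: "symmetric_gram G" and uni: "unimodular G" and ind: "indefinite G"
  shows "\<exists>x. x \<noteq> 0 \<and> bil G x x = 0"
proof -
  obtain l f where l: "\<forall>x\<in>set l. x \<noteq> 0" and surj: "surj f"
    and lin: "\<And>x c y. f (lincomb x c y) = f x + c *s f y"
    and iso: "\<And>x y. rat_bil G (f x) (f y) = diag_form l x y"
    using ex_diagonalization[OF sym uni] by blast
  have sc: "f (\<lambda>i. c * x i) = c *s f x" for c x
  proof -
    have "(\<lambda>i. c * x i) = lincomb x (c - 1) x" by (auto simp: lincomb_def algebra_simps)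
    then show ?thesis by (simp only: lin) (simp add: vec_eq_iff algebra_simps)
  qed
  have "locally_unimodular p (diag_form l)" if p: "prime p" for p
  proof -
    define L where "L = {x. \<forall>i. f x $ i \<in> local_ring p}"
    have "diag_form l v x \<in> local_ring p" if "v \<in> L" "x \<in> L" for v x
      using that p unfolding iso[symmetric] rat_bil_def L_def
      by (auto intro!: local_ring_sum local_ring_mult)
    moreover have "v \<in> L" if v: "\<forall>x\<in>L. diag_form l v x \<in> local_ring p" for v
    proof -
      have "f v $ i \<in> local_ring p" for i
      proof -
        obtain g where g: "\<forall>x. rat_bil G x (rat_vec g) = x $ i" using rat_bil_coordinate[OF uni] by blast
        obtain x where x: "f x = rat_vec g" using surj by (metis surjD)
        then have "x \<in> L" using p by (simp add: L_def rat_vec_def)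
        then have "rat_bil G (f v) (f x) \<in> local_ring p" using v iso by metis
        then show ?thesis using x g by simp
      qed
      then show ?thesis by (simp add: L_def)
    qed
    moreover have "\<exists>k::nat. (\<lambda>i. of_int p ^ k * v i) \<in> L" for v
    proof -
      obtain k where k: "\<And>i. of_int p ^ k i * f v $ i \<in> local_ring p"
        using choice[OF allI, of "\<lambda>i k. of_int p ^ k * f v $ i \<in> local_ring p"] ex_power_mult_local_ring[OF p] by blast
      have "of_int p ^ (\<Sum>i\<in>UNIV. k i) * f v $ i \<in> local_ring p" for i
      proof -
        have "(\<Sum>i\<in>UNIV. k i) = (\<Sum>j\<in>UNIV - {i}. k j) + k i" by (simp add: sum.remove[of UNIV i k])
        then have "of_int p ^ (\<Sum>i\<in>UNIV. k i) * f v $ i =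
            of_int p ^ (\<Sum>j\<in>UNIV - {i}. k j) * (of_int p ^ k i * f v $ i)"
          by (simp add: power_add mult.assoc)
        also have "\<dots> \<in> local_ring p" using k p by (simp only: local_ring_mult local_ring_power local_ring_of_int)
        finally show ?thesis .
      qed
      then show ?thesis by (intro exI[of _ "\<Sum>i\<in>UNIV. k i"]) (simp add: L_def sc)
    qed
    ultimately show ?thesis unfolding locally_unimodular_def self_dual_lattice_def
      by (intro exI[of _ L]) blast
  qed
  then obtain s :: int where s: "s = 1 \<or> s = -1" "witt_definite (of_int s) (diag_form l)"
    using witt_definite_of_locally_unimodular[OF l] by blast
  then obtain L where L: "L \<noteq> {}" "\<forall>x\<in>L. \<forall>y\<in>L. diag_form l x y = 0"
    "\<And>v. \<forall>x\<in>L. diag_form l v x = 0 \<Longrightarrow> v \<in> L \<or> of_int s * diag_form l v v > 0"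
    unfolding witt_definite_def by blast
  have "\<exists>z. of_int s * rat_bil G z z < 0"
  proof -
    obtain x y where "bil G x x > 0" "bil G y y < 0" using ind unfolding indefinite_def by blast
    then have "rat_bil G (rat_vec x) (rat_vec x) > 0" "rat_bil G (rat_vec y) (rat_vec y) < 0"
      by (simp_all add: rat_bil_rat_vec)
    then show ?thesis using s(1) by auto
  qed
  then obtain v where v: "of_int s * diag_form l v v < 0" using surj iso by (metis surjD)
  have "\<exists>x. f x \<noteq> 0 \<and> rat_bil G (f x) (f x) = 0"
  proof (rule ccontr)
    assume "\<not> ?thesis"
    then have f0: "f x = 0" if "x \<in> L" for x using L(2) iso that by metis
    then have "\<forall>x\<in>L. diag_form l v x = 0" by (simp add: rat_bil_zero flip: iso)
    then have "v \<in> L" using L(3) v by force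
    then have "diag_form l v v = 0" using L(2) by blast
    then show False using v by simp
  qed
  then obtain x where x: "f x \<noteq> 0" "rat_bil G (f x) (f x) = 0" by blast
  obtain d y where dy: "d \<noteq> 0" "rat_vec y = of_int d *s f x" using ex_integer_multiple by blast
  have "of_int (bil G y y) = (0::rat)"
    unfolding rat_bil_rat_vec[symmetric] dy(2) by (simp add: rat_bil_scale_left rat_bil_scale_right x(2))
  moreover have "y \<noteq> 0"
  proof
    assume "y = 0"
    then have "of_int d *s f x = 0" using dy(2) by (simp add: rat_vec_def vec_eq_iff)
    then show False using dy(1) x(1) by (simp add: vec_eq_iff)
  qed
  ultimately show ?thesis by auto
qed

section \<open>Isometries of the lattice B(2) + U\<close>

lemma bil_add_left: "bil M (x + y) z = bil M x z + bil M y z"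
  by (simp add: bil_def algebra_simps sum.distrib)

lemma bil_add_right: "bil M z (x + y) = bil M z x + bil M z y"
  by (simp add: bil_def algebra_simps sum.distrib)

lemma bil_scale_left: "bil M (k *s x) z = k * bil M x z"
  by (simp add: bil_def algebra_simps sum_distrib_left)

lemma bil_scale_right: "bil M z (k *s x) = k * bil M z x"
  by (simp add: bil_def algebra_simps sum_distrib_left)

lemma bil_minus_left: "bil M (- x) z = - bil M x z"
  by (simp add: bil_def sum_negf)

lemma bil_minus_right: "bil M z (- x) = - bil M z x"
  by (simp add: bil_def sum_negf)

lemma bil_diff_left: "bil M (x - y) z = bil M x z - bil M y z"
  by (simp add: bil_def algebra_simps sum_subtractf)

lemma bil_diff_right: "bil M z (x - y) = bil M z x - bil M z y"
  by (simp add: bil_def algebra_simps sum_subtractf)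

lemma bil_zero [simp]: "bil M 0 z = 0" "bil M z 0 = 0"
  by (simp_all add: bil_def)

lemmas bil_linear = bil_add_left bil_add_right bil_scale_left bil_scale_right
  bil_minus_left bil_minus_right bil_diff_left bil_diff_right

lemma bil_sym:
  assumes "symmetric_gram M" shows "bil M x y = bil M y x"
proof -
  have "bil M x y = (\<Sum>j\<in>UNIV. \<Sum>i\<in>UNIV. x $ i * M $ i $ j * y $ j)"
    unfolding bil_def by (rule sum.swap)
  also have "\<dots> = bil M y x" unfolding bil_def using assms
    by (intro sum.cong) (auto simp: symmetric_gram_def mult_ac)
  finally show ?thesis .
qed

section \<open>Orbits and the properties constant on them\<close>

lemma orth_groupI:
  assumes "\<And>x y. h (x + y) = h x + h y" "\<And>k x. h (k *s x) = k *s h x"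
    "\<And>x y. bil M (h x) (h y) = bil M x y" "\<And>x. g (h x) = x" "\<And>x. h (g x) = x"
  shows "h \<in> orth_group M"
  using assms unfolding orth_group_def by (auto intro: bij_betw_byWitness[of _ g])

lemma equiv_orbit_rel: "equiv UNIV (orbit_rel M)"
proof (rule equivI)
  have "id \<in> orth_group M" by (simp add: orth_group_def)
  then show "refl (orbit_rel M)" unfolding orbit_rel_def refl_on_def by (auto intro!: bexI[of _ id])
  show "sym (orbit_rel M)"
  proof (rule symI)
    fix x y assume "(x, y) \<in> orbit_rel M"
    then obtain h where h: "h \<in> orth_group M" "h x = y" by (auto simp: orbit_rel_def)
    then have bij: "bij h" and lin: "\<And>x y. h (x + y) = h x + h y" "\<And>k x. h (k *s x) = k *s h x"
      "\<And>x y. bil M (h x) (h y) = bil M x y" by (auto simp: orth_group_def)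
    define g where "g = inv h"
    have hg: "h (g z) = z" and gh: "g (h z) = z" for z
      using bij by (simp_all add: g_def bij_is_surj surj_f_inv_f bij_is_inj)
    have "g \<in> orth_group M"
      by (rule orth_groupI[where g = h]) (metis hg gh lin)+
    then show "(y, x) \<in> orbit_rel M" using h(2) gh by (auto simp: orbit_rel_def)
  qed
  show "trans (orbit_rel M)"
  proof (rule transI)
    fix x y z assume "(x, y) \<in> orbit_rel M" "(y, z) \<in> orbit_rel M"
    then obtain g h where "g \<in> orth_group M" "g x = y" "h \<in> orth_group M" "h y = z"
      by (auto simp: orbit_rel_def)
    then have "h \<circ> g \<in> orth_group M" "(h \<circ> g) x = z" by (auto simp: orth_group_def bij_comp)
    then show "(x, z) \<in> orbit_rel M" unfolding orbit_rel_def by blast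
  qed
qed simp

lemma orbit_rel_trans: "(x, y) \<in> orbit_rel M \<Longrightarrow> (y, z) \<in> orbit_rel M \<Longrightarrow> (x, z) \<in> orbit_rel M"
  using equiv_orbit_rel[of M] by (auto simp: equiv_def dest: transD)

lemma orbit_rel_sym: "(x, y) \<in> orbit_rel M \<Longrightarrow> (y, x) \<in> orbit_rel M"
  using equiv_orbit_rel[of M] by (auto simp: equiv_def dest: symD)

lemma orbit_rel_refl: "(x, x) \<in> orbit_rel M"
  using equiv_orbit_rel[of M] by (auto simp: equiv_def dest: refl_onD)

lemma orbit_rel_bil: "(x, y) \<in> orbit_rel M \<Longrightarrow> bil M x x = bil M y y"
  by (auto simp: orbit_rel_def orth_group_def)

lemma orbit_rel_primitive:
  assumes "(x, y) \<in> orbit_rel M" "primitive x" shows "primitive y"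
proof -
  obtain h where h: "h \<in> orth_group M" "h y = x" using orbit_rel_sym[OF assms(1)] by (auto simp: orbit_rel_def)
  then have lin: "\<And>k x. h (k *s x) = k *s h x" by (auto simp: orth_group_def)
  have "h 0 = 0" using lin[of 0 0] by simp
  then have "y \<noteq> 0" using h(2) assms(2) by (auto simp: primitive_def)
  moreover have "k = 1 \<or> k = -1" if "y = k *s v" for k v
    using h(2) lin[of k v] that assms(2) unfolding primitive_def by metis
  ultimately show ?thesis unfolding primitive_def by blast
qed

text \<open>The orbit invariant that separates the two normal forms for even n.\<close>

definition even_vector :: "int^'m^'m \<Rightarrow> int^'m \<Rightarrow> bool" where
  "even_vector M w \<longleftrightarrow> (\<forall>v. even (bil M w v))"

lemma orbit_rel_even_vector:
  assumes "(x, y) \<in> orbit_rel M" "even_vector M x" shows "even_vector M y"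
proof -
  obtain h where h: "h \<in> orth_group M" "h x = y" using assms by (auto simp: orbit_rel_def)
  then have "surj h" "\<And>x y. bil M (h x) (h y) = bil M x y" by (auto simp: orth_group_def bij_is_surj)
  then show ?thesis using h(2) assms(2) unfolding even_vector_def by (metis surjD)
qed

section \<open>Coordinates on B(2) + U and explicit isometries\<close>

definition triple :: "int^'n \<Rightarrow> int \<Rightarrow> int \<Rightarrow> int^('n + bool)" where
  "triple b x y = (\<chi> i. case i of Inl a \<Rightarrow> b $ a | Inr q \<Rightarrow> if q then y else x)"

definition base_part :: "int^('n + bool) \<Rightarrow> int^'n" where
  "base_part w = (\<chi> a. w $ Inl a)"

lemma triple_exhaust: "w = triple (base_part w) (w $ Inr False) (w $ Inr True)"
  by (auto simp: vec_eq_iff triple_def base_part_def split: sum.splits)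

lemma triple_simps [simp]: 
  "base_part (triple b x y) = b" "triple b x y $ Inr False = x" "triple b x y $ Inr True = y"
  by (simp_all add: vec_eq_iff triple_def base_part_def)

lemma triple_add: "triple b x y + triple b' x' y' = triple (b + b') (x + x') (y + y')"
  by (auto simp: vec_eq_iff triple_def split: sum.splits)

lemma triple_scale: "k *s triple b x y = triple (k *s b) (k * x) (k * y)"
  by (auto simp: vec_eq_iff triple_def split: sum.splits)

lemma triple_eq_iff: "triple b x y = triple b' x' y' \<longleftrightarrow> b = b' \<and> x = x' \<and> y = y'"
  by (metis triple_simps)

lemma bil_triple:
  fixes G :: "int^'n^'n"
  shows "bil (twice_plus_U G) (triple b x y) (triple b' x' y') = 2 * bil G b b' + x * y' + y * x'"
proof -
  have "(\<Sum>i\<in>(UNIV :: ('n + bool) set). g i) = (\<Sum>a\<in>UNIV. g (Inl a)) + (g (Inr False) + g (Inr True))"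
    for g :: "'n + bool \<Rightarrow> int"
  proof -
    have "sum g (UNIV <+> UNIV) = (\<Sum>a\<in>UNIV. g (Inl a)) + (\<Sum>q\<in>UNIV. g (Inr q))"
      by (subst sum.Plus) (simp_all add: comp_def)
    then show ?thesis by (simp only: UNIV_Plus_UNIV) (simp add: UNIV_bool)
  qed
  then show ?thesis
    by (simp add: bil_def twice_plus_U_def triple_def sum_distrib_left algebra_simps)
qed

lemma orbit_tripleI:
  fixes G :: "int^'n^'n" and h :: "int^'n \<Rightarrow> int \<Rightarrow> int \<Rightarrow> int^('n + bool)"
  assumes "\<And>b x y b' x' y'. h (b + b') (x + x') (y + y') = h b x y + h b' x' y'"
    "\<And>k b x y. h (k *s b) (k * x) (k * y) = k *s h b x y"
    "\<And>b x y b' x' y'. bil (twice_plus_U G) (h b x y) (h b' x' y') = 2 * bil G b b' + x * y' + y * x'"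
    "\<And>b x y. g (h b x y) = triple b x y"
    "\<And>w. h (base_part (g w)) (g w $ Inr False) (g w $ Inr True) = w"
  shows "(triple b x y, h b x y) \<in> orbit_rel (twice_plus_U G)"
proof -
  define H where "H w = h (base_part w) (w $ Inr False) (w $ Inr True)" for w
  have "H \<in> orth_group (twice_plus_U G)"
  proof (rule orth_groupI[where g = g])
    fix v w k
    show "H (v + w) = H v + H w" unfolding H_def assms(1)[symmetric] by (simp add: base_part_def vec_eq_iff plus_vec_def)
    show "H (k *s v) = k *s H v" unfolding H_def assms(2)[symmetric] by (simp add: base_part_def vector_scalar_mult_def)
    show "bil (twice_plus_U G) (H v) (H w) = bil (twice_plus_U G) v w" unfolding H_def assms(3)
      using bil_triple[of G "base_part v" "v $ Inr False" "v $ Inr True" "base_part w" "w $ Inr False" "w $ Inr True"]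
      by (simp flip: triple_exhaust)
    show "g (H v) = v" unfolding H_def assms(4) by (rule triple_exhaust[symmetric])
    show "H (g v) = v" unfolding H_def by (rule assms(5))
  qed
  moreover have "H (triple b x y) = h b x y" by (simp add: H_def)
  ultimately show ?thesis unfolding orbit_rel_def by blast
qed

lemma orbit_swap: "(triple b x y, triple b y x) \<in> orbit_rel (twice_plus_U G)"
  by (rule orbit_tripleI[where g = "\<lambda>w. triple (base_part w) (w $ Inr True) (w $ Inr False)"])
    (simp_all add: triple_add triple_scale bil_triple flip: triple_exhaust)

lemma orbit_neg_plane: "(triple b x y, triple b (- x) (- y)) \<in> orbit_rel (twice_plus_U G)"
  by (rule orbit_tripleI[where g = "\<lambda>w. triple (base_part w) (- (w $ Inr False)) (- (w $ Inr True))"])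
    (simp_all add: triple_add triple_scale bil_triple flip: triple_exhaust)

lemma orbit_neg_base: "(triple b x y, triple (- b) x y) \<in> orbit_rel (twice_plus_U G)"
  by (rule orbit_tripleI[where g = "\<lambda>w. triple (- base_part w) (w $ Inr False) (w $ Inr True)"])
    (simp_all add: triple_add triple_scale bil_triple bil_minus_left bil_minus_right vec_eq_iff[where x = "- _"] flip: triple_exhaust)

lemma orbit_base:
  assumes "h \<in> orth_group G"
  shows "(triple b x y, triple (h b) x y) \<in> orbit_rel (twice_plus_U G)"
proof -
  have h: "bij h" "\<And>x y. h (x + y) = h x + h y" "\<And>k x. h (k *s x) = k *s h x"
    "\<And>x y. bil G (h x) (h y) = bil G x y" using assms by (auto simp: orth_group_def)
  then have "inv h (h b) = b" "h (inv h b) = b" for b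
    by (simp_all add: bij_is_inj bij_is_surj surj_f_inv_f)
  then show ?thesis
    by (intro orbit_tripleI[where g = "\<lambda>w. triple (inv h (base_part w)) (w $ Inr False) (w $ Inr True)"])
      (simp_all add: h triple_add triple_scale bil_triple flip: triple_exhaust)
qed

text \<open>The transvection fixes the isotropic vector (0, 0, 1); the change of y compensates the
  change of the norm of b, and the inverse is the transvection by -a.\<close>

lemma orbit_transvection:
  assumes sym: "symmetric_gram G"
  shows "(triple b x y, triple (b + x *s a) x (y - 2 * bil G a b - x * bil G a a)) \<in> orbit_rel (twice_plus_U G)"
proof (rule orbit_tripleI[where g = "\<lambda>w. triple (base_part w - (w $ Inr False) *s a) (w $ Inr False)
    (w $ Inr True + 2 * bil G a (base_part w) - w $ Inr False * bil G a a)"])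
  fix b x y b' x' y' k
  show "triple (b + b' + (x + x') *s a) (x + x') (y + y' - 2 * bil G a (b + b') - (x + x') * bil G a a) =
      triple (b + x *s a) x (y - 2 * bil G a b - x * bil G a a) +
      triple (b' + x' *s a) x' (y' - 2 * bil G a b' - x' * bil G a a)"
    by (simp add: triple_add triple_eq_iff bil_linear vec_eq_iff algebra_simps)
  show "triple (k *s b + (k * x) *s a) (k * x) (k * y - 2 * bil G a (k *s b) - k * x * bil G a a) =
      k *s triple (b + x *s a) x (y - 2 * bil G a b - x * bil G a a)"
    by (simp add: triple_scale triple_eq_iff bil_linear vec_eq_iff algebra_simps)
  show "bil (twice_plus_U G) (triple (b + x *s a) x (y - 2 * bil G a b - x * bil G a a))
      (triple (b' + x' *s a) x' (y' - 2 * bil G a b' - x' * bil G a a)) = 2 * bil G b b' + x * y' + y * x'"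
    using bil_sym[OF sym, of b a] by (simp add: bil_triple bil_linear algebra_simps)
qed (simp_all add: bil_linear triple_eq_iff flip: triple_exhaust)

section \<open>Normal forms of primitive vectors\<close>

text \<open>Unimodularity is used in the form \<open>coordinate\<close>: each coordinate functional
  is the pairing with a lattice vector.\<close>

locale hyperbolic_pair =
  fixes G :: "int^'n^'n" and e f :: "int^'n"
  assumes sym: "symmetric_gram G" and even: "even_lattice G"
    and coordinate: "\<And>i. \<exists>g. \<forall>x. bil G x g = x $ i"
    and ee: "bil G e e = 0" and ff: "bil G f f = 0" and ef: "bil G e f = 1"
begin

abbreviation equivalent (infix "\<doteq>" 50) where
  "v \<doteq> w \<equiv> (v, w) \<in> orbit_rel (twice_plus_U G)"

lemma equivalent_trans [trans]: "u \<doteq> v \<Longrightarrow> v \<doteq> w \<Longrightarrow> u \<doteq> w"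
  by (rule orbit_rel_trans)

lemma fe: "bil G f e = 1"
  using ef bil_sym[OF sym, of f e] by simp

lemma divisible_vector:
  assumes "\<And>t. k dvd bil G b t" obtains c where "b = k *s c"
proof -
  have "\<exists>c. b $ i = k * c" for i using coordinate[of i] assms by (metis dvdE)
  then obtain c where "\<And>i. b $ i = k * c i" by metis
  then have "b = k *s (\<chi> i. c i)" by (simp add: vec_eq_iff)
  then show ?thesis using that by blast
qed

lemma transvection: "triple b x y \<doteq> triple (b + x *s a) x (y - 2 * bil G a b - x * bil G a a)"
  by (rule orbit_transvection[OF sym])

lemma transvection': "triple b x y \<doteq> triple (b + y *s a) (x - 2 * bil G a b - y * bil G a a) y"
  using orbit_swap[of b x y G] transvection[of b y x a] orbit_swap[of "b + y *s a" y] orbit_rel_trans by blast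

subsection \<open>Vectors with an odd pairing\<close>

text \<open>The remainder of least absolute value is taken because the division that follows is
  modulo twice this remainder.\<close>

lemma ex_centered_remainder: "(m::int) \<noteq> 0 \<Longrightarrow> \<exists>k. 2 * \<bar>a + k * m\<bar> \<le> \<bar>m\<bar>"
proof -
  assume m: "m \<noteq> 0"
  define r where "r = a mod \<bar>m\<bar>"
  have r: "0 \<le> r" "r < \<bar>m\<bar>" using m by (simp_all add: r_def)
  have a: "a = r + (a div \<bar>m\<bar>) * sgn m * m"
    by (simp add: r_def mult.assoc flip: abs_sgn[of m, unfolded mult.commute[of m]]) 
  show ?thesis
  proof (cases "2 * r \<le> \<bar>m\<bar>")
    case True
    have "a + (- ((a div \<bar>m\<bar>) * sgn m)) * m = r" using a by simp
    then show ?thesis using True r by (metis abs_of_nonneg)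
  next
    case False
    have "a + (- ((a div \<bar>m\<bar>) * sgn m) - sgn m) * m = r - \<bar>m\<bar>" using a by (simp add: algebra_simps abs_sgn)
    then show ?thesis using False r by (intro exI[of _ "- ((a div \<bar>m\<bar>) * sgn m) - sgn m"]) simp
  qed
qed

text \<open>Transvections by multiples of the isotropic z change x by multiples of 2<z,b>. The
  pairing t = <z,b> is first reduced modulo x, by means of a, until 2|t| < |x|, equality being
  impossible for odd x; then x is reduced modulo 2t and stays odd.\<close>

lemma odd_pairing_descent:
  assumes x: "odd x" and z: "bil G z z = 0" "bil G z a = 1" and nd: "\<not> x dvd bil G z b"
  shows "\<exists>b' x' y'. triple b x y \<doteq> triple b' x' y' \<and> odd x' \<and> \<bar>x'\<bar> < \<bar>x\<bar>"
proof -
  have "x \<noteq> 0" using x by auto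
  then obtain k where k: "2 * \<bar>bil G z b + k * x\<bar> \<le> \<bar>x\<bar>" using ex_centered_remainder by blast
  define t where "t = bil G z b + k * x"
  have "\<not> x dvd t" using nd by (simp add: t_def)
  then have t0: "t \<noteq> 0" by auto
  have "2 * \<bar>t\<bar> \<noteq> \<bar>x\<bar>" using x by (metis abs_dvd_iff dvd_abs_iff dvd_triv_left even_abs_add_iff)
  then have lt: "2 * \<bar>t\<bar> < \<bar>x\<bar>" using k by (simp add: t_def)
  define b1 where "b1 = b + x *s (k *s a)"
  define y1 where "y1 = y - 2 * bil G (k *s a) b - x * bil G (k *s a) (k *s a)"
  have zb: "bil G z b1 = t" using z(2) by (simp add: b1_def t_def bil_linear)
  define j where "j = x div (2 * t)"
  define x' where "x' = x mod (2 * t)"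
  have "triple b x y \<doteq> triple b1 x y1" unfolding b1_def y1_def by (rule transvection)
  also have "triple b1 x y1 \<doteq> triple (b1 + y1 *s (j *s z)) (x - 2 * bil G (j *s z) b1 - y1 * bil G (j *s z) (j *s z)) y1"
    by (rule transvection')
  also have "x - 2 * bil G (j *s z) b1 - y1 * bil G (j *s z) (j *s z) = x'"
    using z(1) zb by (simp add: bil_linear x'_def j_def minus_mult_div_eq_mod[symmetric] algebra_simps)
  finally have "triple b x y \<doteq> triple (b1 + y1 *s (j *s z)) x' y1" .
  moreover have "odd x'" using x unfolding x'_def by (metis dvd_mod_iff dvd_triv_left)
  moreover have "\<bar>x'\<bar> < \<bar>x\<bar>" using abs_mod_less[of "2 * t" x] t0 lt by (simp add: x'_def abs_mult)
  ultimately show ?thesis by (intro exI conjI)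
qed

text \<open>Isotropic vectors having a partner of pairing 1 span the lattice: besides e and f, each
  t' orthogonal to both yields t' - ce + f, where 2c is the norm of t'.\<close>

lemma isotropic_pairings_span:
  assumes "\<And>z a. bil G z z = 0 \<Longrightarrow> bil G z a = 1 \<Longrightarrow> x dvd bil G z b"
  shows "x dvd bil G b t"
proof -
  define t' where "t' = t - bil G t f *s e - bil G t e *s f"
  have t': "bil G t' e = 0" "bil G t' f = 0" "bil G e t' = 0" "bil G f t' = 0"
    using ee ff ef fe bil_sym[OF sym, of e t] bil_sym[OF sym, of f t] by (simp_all add: t'_def bil_linear)
  obtain c where c: "bil G t' t' = 2 * c" using even unfolding even_lattice_def by blast
  define z where "z = t' - c *s e + f"
  have zz: "bil G z z = 0" "bil G z e = 1" using t' c ee ff ef fe by (simp_all add: z_def bil_linear)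
  have d: "x dvd bil G z b" "x dvd bil G e b" "x dvd bil G f b"
    using assms[OF zz] assms[OF ee ef] assms[OF ff fe] by blast+
  have "t = z + c *s e - f + bil G t f *s e + bil G t e *s f" by (simp add: z_def t'_def)
  then have "bil G t b = bil G z b + c * bil G e b - bil G f b + bil G t f * bil G e b + bil G t e * bil G f b"
    by (metis bil_add_left bil_diff_left bil_scale_left)
  then have "x dvd bil G t b" using d by simp
  then show ?thesis using bil_sym[OF sym] by metis
qed

text \<open>If no descent applies, x divides b and a transvection clears b. Then either x divides
  the last coordinate too, and primitivity gives x = 1 or -1, or that coordinate is copied into b
  along e, where its pairing with f permits a descent.\<close>

lemma primitive_odd_normal_form:
  assumes "primitive (triple b x y)" "odd x"
  shows "\<exists>m. triple b x y \<doteq> triple 0 1 m"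
  using assms
proof (induction "nat \<bar>x\<bar>" arbitrary: b x y rule: less_induct)
  case less
  have step: ?case if st: "triple b x y \<doteq> triple b' x y'" "bil G z z = 0" "bil G z a = 1" "\<not> x dvd bil G z b'" for b' y' z a
  proof -
    obtain b1 x1 y1 where h: "triple b' x y' \<doteq> triple b1 x1 y1" "odd x1" "\<bar>x1\<bar> < \<bar>x\<bar>"
      using odd_pairing_descent[OF less.prems(2) st(2-4)] by blast
    have eq: "triple b x y \<doteq> triple b1 x1 y1" using st(1) h(1) by (rule equivalent_trans)
    then have "primitive (triple b1 x1 y1)" using less.prems(1) orbit_rel_primitive by blast
    moreover have "nat \<bar>x1\<bar> < nat \<bar>x\<bar>" using h(3) by linarith
    ultimately show ?thesis using less.hyps h(2) equivalent_trans[OF eq] by blast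
  qed
  show ?case
  proof (cases "\<exists>z a. bil G z z = 0 \<and> bil G z a = 1 \<and> \<not> x dvd bil G z b")
    case True
    then show ?thesis using step[OF orbit_rel_refl] by blast
  next
    case False
    then obtain c where c: "b = x *s c" using isotropic_pairings_span[of x b] divisible_vector[of x b] by metis
    obtain y1 where y1: "triple b x y \<doteq> triple 0 x y1"
      using transvection[of b x y "- c"] unfolding c by (auto simp: vector_smult_rneg)
    show ?thesis
    proof (cases "x dvd y1")
      case True
      then obtain m where "y1 = x * m" by blast
      then have "triple 0 x y1 = x *s triple 0 1 m" by (simp add: triple_scale)
      moreover have "primitive (triple (0 :: int^'n) x y1)" using y1 less.prems(1) orbit_rel_primitive by blast
      ultimately have "x = 1 \<or> x = -1" unfolding primitive_def by metis
      then show ?thesis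
      proof
        assume "x = -1"
        then have "triple (0 :: int^'n) x y1 \<doteq> triple 0 1 (- y1)" using orbit_neg_plane[of 0 x y1 G] by simp
        then show ?thesis using equivalent_trans[OF y1] by blast
      qed (use y1 in blast)
    next
      case False
      have "triple 0 x y1 \<doteq> triple (y1 *s e) x y1" using transvection'[of 0 x y1 e] by (simp add: ee)
      then have "triple b x y \<doteq> triple (y1 *s e) x y1" using equivalent_trans[OF y1] by blast
      moreover have "\<not> x dvd bil G f (y1 *s e)" using False by (simp add: bil_linear fe)
      ultimately show ?thesis using step[OF _ ff fe] by blast
    qed
  qed
qed

subsection \<open>Vectors with only even pairings\<close>

text \<open>In terms of the halves x and y the pairing enters with coefficient 1, while b changes by
  multiples of 2x.\<close>

lemma even_transvection:
  "triple b (2 * x) (2 * y) \<doteq> triple (b + (2 * x) *s a) (2 * x) (2 * (y - bil G a b - x * bil G a a))"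
  using transvection[of b "2 * x" "2 * y" a] by (simp add: algebra_simps)

lemma even_transvection':
  "triple b (2 * x) (2 * y) \<doteq> triple (b + (2 * y) *s a) (2 * (x - bil G a b - y * bil G a a)) (2 * y)"
  using transvection'[of b "2 * x" "2 * y" a] by (simp add: algebra_simps)

text \<open>The mirror image of \<open>odd_pairing_descent\<close>: transvections along e reduce x
  modulo \<beta> = <e,b> until 2|x| < |\<beta>|, strict because \<beta> is odd; transvections along
  f then reduce \<beta> modulo 2x.\<close>

lemma even_pairing_descent:
  assumes \<beta>: "odd (bil G e b)" and nd: "\<not> bil G e b dvd x"
  shows "\<exists>b' x' y'. triple b (2 * x) (2 * y) \<doteq> triple b' (2 * x') (2 * y') \<and> odd (bil G e b') \<and>
    \<bar>bil G e b'\<bar> < \<bar>bil G e b\<bar>"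
proof -
  define \<beta> where "\<beta> = bil G e b"
  have "\<beta> \<noteq> 0" using assms(1) by (auto simp: \<beta>_def)
  then obtain k where k: "2 * \<bar>x + k * \<beta>\<bar> \<le> \<bar>\<beta>\<bar>" using ex_centered_remainder by blast
  define x1 where "x1 = x + k * \<beta>"
  have "\<not> \<beta> dvd x1" using nd by (simp add: x1_def \<beta>_def)
  then have x0: "x1 \<noteq> 0" by auto
  have "2 * \<bar>x1\<bar> \<noteq> \<bar>\<beta>\<bar>" using assms(1) by (metis abs_dvd_iff dvd_abs_iff dvd_triv_left even_abs_add_iff \<beta>_def)
  then have lt: "2 * \<bar>x1\<bar> < \<bar>\<beta>\<bar>" using k by (simp add: x1_def)
  define b1 where "b1 = b + (2 * y) *s ((- k) *s e)"
  have b1: "bil G e b1 = \<beta>" by (simp add: b1_def bil_linear ee \<beta>_def)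
  have "triple b (2 * x) (2 * y) \<doteq> triple b1 (2 * (x - bil G ((- k) *s e) b - y * bil G ((- k) *s e) ((- k) *s e))) (2 * y)"
    unfolding b1_def by (rule even_transvection')
  also have "x - bil G ((- k) *s e) b - y * bil G ((- k) *s e) ((- k) *s e) = x1"
    by (simp add: bil_linear ee x1_def \<beta>_def)
  finally have eq: "triple b (2 * x) (2 * y) \<doteq> triple b1 (2 * x1) (2 * y)" .
  define j where "j = - (\<beta> div (2 * x1))"
  define b2 where "b2 = b1 + (2 * x1) *s (j *s f)"
  have "bil G e b2 = \<beta> mod (2 * x1)"
    by (simp add: b2_def bil_linear b1 ef j_def minus_mult_div_eq_mod[symmetric])
  moreover have "odd (\<beta> mod (2 * x1))" using assms(1) unfolding \<beta>_def by (metis dvd_mod_iff dvd_triv_left)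
  moreover have "\<bar>\<beta> mod (2 * x1)\<bar> < \<bar>\<beta>\<bar>" using abs_mod_less[of "2 * x1" \<beta>] x0 lt by (simp add: abs_mult)
  moreover obtain y2 where "triple b1 (2 * x1) (2 * y) \<doteq> triple b2 (2 * x1) (2 * y2)"
    using even_transvection[of b1 x1 y "j *s f"] unfolding b2_def by blast
  ultimately show ?thesis using equivalent_trans[OF eq] unfolding \<beta>_def by metis
qed

text \<open>The Eichler transvection inside the lattice of G, along the isotropic u by a vector c
  orthogonal to it; q is half the norm of c.\<close>

lemma base_transvection:
  assumes u: "bil G u u = 0" and c: "bil G u c = 0" "bil G c c = 2 * q"
  shows "(\<lambda>b. b + bil G b u *s c - bil G b c *s u - (q * bil G b u) *s u) \<in> orth_group G"
proof (rule orth_groupI[where g = "\<lambda>b. b - bil G b u *s c + bil G b c *s u - (q * bil G b u) *s u"])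
  have cu: "bil G c u = 0" using c(1) bil_sym[OF sym] by metis
  fix x y :: "int^'n" and k
  show "bil G (x + bil G x u *s c - bil G x c *s u - (q * bil G x u) *s u)
      (y + bil G y u *s c - bil G y c *s u - (q * bil G y u) *s u) = bil G x y"
    using bil_sym[OF sym, of u y] bil_sym[OF sym, of c y] by (simp add: bil_linear cu u c algebra_simps)
qed (simp_all add: bil_linear u c bil_sym[OF sym, of c u] vec_eq_iff algebra_simps)

lemma base_reflection:
  assumes v: "bil G v v = - 2"
  shows "(\<lambda>b. b + bil G b v *s v) \<in> orth_group G"
proof (rule orth_groupI[where g = "\<lambda>b. b + bil G b v *s v"])
  fix x y :: "int^'n"
  show "bil G (x + bil G x v *s v) (y + bil G y v *s v) = bil G x y"
    using bil_sym[OF sym, of v y] by (simp add: bil_linear v algebra_simps)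
qed (simp_all add: bil_linear v vec_eq_iff algebra_simps)

text \<open>If b pairs oddly with f, the reflection in e - f, which exchanges e and f, helps. If b
  pairs evenly with both, the part c of t orthogonal to e and f still pairs oddly with b, and the
  transvection along f by c changes <e,b> by an odd number.\<close>

lemma ex_odd_pairing_with_e:
  assumes "odd (bil G b t)"
  shows "\<exists>h\<in>orth_group G. odd (bil G e (h b))"
proof -
  have sb: "bil G e b = bil G b e" "bil G f b = bil G b f" using bil_sym[OF sym] by metis+
  consider "odd (bil G b e)" | "even (bil G b e)" "odd (bil G b f)" | "even (bil G b e)" "even (bil G b f)" by blast
  then show ?thesis
  proof cases
    case 1
    moreover have "id \<in> orth_group G" by (simp add: orth_group_def)
    ultimately show ?thesis using sb by (intro bexI[of _ id]) simp_all
  next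
    case 2
    have "bil G (e - f) (e - f) = - 2" by (simp add: bil_linear ee ff ef fe)
    from base_reflection[OF this] 2 show ?thesis
      by (intro bexI[of _ "\<lambda>b. b + bil G b (e - f) *s (e - f)"]) (simp_all add: bil_linear ee ef sb)
  next
    case 3
    define c where "c = t - bil G t f *s e - bil G t e *s f"
    have c: "bil G f c = 0" "bil G e c = 0"
      using ee ff ef fe bil_sym[OF sym, of e t] bil_sym[OF sym, of f t] by (simp_all add: c_def bil_linear)
    obtain q where q: "bil G c c = 2 * q" using even unfolding even_lattice_def by blast
    have "odd (bil G b c)" using assms 3 by (simp add: c_def bil_linear)
    then have "odd (bil G e (b + bil G b f *s c - bil G b c *s f - (q * bil G b f) *s f))"
      using 3 by (simp add: bil_linear c ef sb)
    then show ?thesis by (intro bexI[OF _ base_transvection[OF ff c(1) q]])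
  qed
qed

text \<open>If <e,b> divides x and y, transvections by multiples of e clear both without changing
  <e,b>. Any pairing of b not divisible by <e,b> can then be moved into the vacated coordinate,
  which permits a descent; if there is none, b is divisible by <e,b> and primitivity leaves 1 or
  -1.\<close>

lemma primitive_even_normal_form_aux:
  assumes "primitive (triple b (2 * x) (2 * y))" "odd (bil G e b)"
  shows "\<exists>k. triple b (2 * x) (2 * y) \<doteq> triple (f + k *s e) 0 0"
  using assms
proof (induction "nat \<bar>bil G e b\<bar>" arbitrary: b x y rule: less_induct)
  case less
  define \<beta> where "\<beta> = bil G e b"
  have step: ?case if st: "triple b (2 * x) (2 * y) \<doteq> triple b' (2 * x') (2 * y')" "bil G e b' = \<beta>" "\<not> \<beta> dvd x'" for b' x' y'
  proof -
    obtain b1 x1 y1 where h: "triple b' (2 * x') (2 * y') \<doteq> triple b1 (2 * x1) (2 * y1)"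
      "odd (bil G e b1)" "\<bar>bil G e b1\<bar> < \<bar>\<beta>\<bar>"
      using even_pairing_descent[of b' x' y'] st(2,3) less.prems(2) unfolding \<beta>_def by metis
    have eq: "triple b (2 * x) (2 * y) \<doteq> triple b1 (2 * x1) (2 * y1)" using st(1) h(1) by (rule equivalent_trans)
    then have "primitive (triple b1 (2 * x1) (2 * y1))" using less.prems(1) orbit_rel_primitive by blast
    moreover have "nat \<bar>bil G e b1\<bar> < nat \<bar>bil G e b\<bar>" using h(3) unfolding \<beta>_def by linarith
    ultimately show ?thesis using less.hyps h(2) equivalent_trans[OF eq] by blast
  qed
  show ?case
  proof (cases "\<beta> dvd x \<and> \<beta> dvd y")
    case False
    then show ?thesis using step[OF orbit_rel_refl] step[OF orbit_swap] \<beta>_def by blast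
  next
    case True
    then obtain i j where ij: "x = \<beta> * i" "y = \<beta> * j" by (meson dvdE)
    define b1 where "b1 = b + (2 * y) *s (i *s e)"
    have b1: "bil G e b1 = \<beta>" by (simp add: b1_def bil_linear ee \<beta>_def)
    have "triple b (2 * x) (2 * y) \<doteq> triple b1 (2 * (x - bil G (i *s e) b - y * bil G (i *s e) (i *s e))) (2 * y)"
      unfolding b1_def by (rule even_transvection')
    also have "x - bil G (i *s e) b - y * bil G (i *s e) (i *s e) = 0"
      using ij(1) by (simp add: bil_linear ee \<beta>_def mult.commute)
    finally have "triple b (2 * x) (2 * y) \<doteq> triple b1 (2 * 0) (2 * y)" .
    also have "triple b1 (2 * 0) (2 * y) \<doteq> triple (b1 + (2 * 0) *s (j *s e)) (2 * 0) (2 * (y - bil G (j *s e) b1 - 0 * bil G (j *s e) (j *s e)))"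
      by (rule even_transvection)
    also have "y - bil G (j *s e) b1 - 0 * bil G (j *s e) (j *s e) = 0"
      using ij(2) by (simp add: bil_linear b1 mult.commute)
    finally have eq: "triple b (2 * x) (2 * y) \<doteq> triple b1 (2 * 0) (2 * 0)" by simp
    show ?thesis
    proof (cases "\<exists>a. \<not> \<beta> dvd bil G a b1")
      case True
      then obtain a where a: "\<not> \<beta> dvd bil G a b1" by blast
      have "triple b1 (2 * 0) (2 * 0) \<doteq> triple b1 (2 * (- bil G a b1)) (2 * 0)"
        using even_transvection'[of b1 0 0 a] by simp
      then show ?thesis using step[OF equivalent_trans[OF eq] b1] a by (metis dvd_minus_iff)
    next
      case False
      then have "\<beta> dvd bil G b1 t" for t using bil_sym[OF sym, of b1 t] by auto
      then obtain c where c: "b1 = \<beta> *s c" using divisible_vector by blast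
      then have "triple b1 (2 * 0) (2 * 0) = \<beta> *s triple c 0 0" by (simp add: triple_scale)
      moreover have "primitive (triple b1 (2 * 0) (2 * 0))" using eq less.prems(1) orbit_rel_primitive by blast
      ultimately have "\<beta> = 1 \<or> \<beta> = -1" unfolding primitive_def by metis
      then obtain b2 where b2: "triple b (2 * x) (2 * y) \<doteq> triple b2 0 0" "bil G e b2 = 1"
      proof
        assume "\<beta> = 1"
        then show ?thesis using that[of b1] eq b1 by simp
      next
        assume "\<beta> = -1"
        then show ?thesis using that[of "- b1"] equivalent_trans[OF eq] orbit_neg_base[of b1 0 0 G] b1
          by (simp add: bil_linear)
      qed
      \<comment> \<open>As <e,b2> = 1, this is minus the component of b2 orthogonal to e and f;
        adding it to b2 leaves f plus a multiple of e.\<close>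
      define c' where "c' = f + bil G b2 f *s e - b2"
      have be: "bil G b2 e = 1" "bil G f b2 = bil G b2 f" using b2(2) bil_sym[OF sym] by metis+
      have c': "bil G e c' = 0" by (simp add: c'_def bil_linear ee ef b2(2))
      obtain q where q: "bil G c' c' = 2 * q" using even unfolding even_lattice_def by blast
      have nf: "b2 + bil G b2 e *s c' - bil G b2 c' *s e - (q * bil G b2 e) *s e =
          f + (bil G b2 f - bil G b2 c' - q) *s e"
        by (simp add: be c'_def vec_eq_iff algebra_simps)
      have "triple b2 0 0 \<doteq> triple (f + (bil G b2 f - bil G b2 c' - q) *s e) 0 0"
        using orbit_base[OF base_transvection[OF ee c' q], of b2 0 0] unfolding nf .
      then show ?thesis using equivalent_trans[OF b2(1)] by blast
    qed
  qed
qed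

lemma primitive_even_normal_form:
  assumes "primitive (triple b (2 * x) (2 * y))"
  shows "\<exists>k. triple b (2 * x) (2 * y) \<doteq> triple (f + k *s e) 0 0"
proof -
  have "\<exists>t. odd (bil G b t)"
  proof (rule ccontr)
    assume "\<not> ?thesis"
    then obtain c where "b = 2 *s c" using divisible_vector[of 2 b] by blast
    then have "triple b (2 * x) (2 * y) = 2 *s triple c x y" by (simp add: triple_scale)
    then show False using assms unfolding primitive_def by fastforce
  qed
  then obtain h where h: "h \<in> orth_group G" "odd (bil G e (h b))" using ex_odd_pairing_with_e by blast
  have eq: "triple b (2 * x) (2 * y) \<doteq> triple (h b) (2 * x) (2 * y)" by (rule orbit_base[OF h(1)])
  then show ?thesis
    using primitive_even_normal_form_aux[OF orbit_rel_primitive[OF eq assms] h(2)] equivalent_trans[OF eq] by blast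
qed

lemma primitive_triple_01: "primitive (triple (0 :: int^'n) 1 m)"
proof -
  have "k = 1 \<or> k = -1" if "triple (0 :: int^'n) 1 m = k *s v" for k v
  proof -
    have "1 = k * v $ Inr False" using arg_cong[OF that, of "\<lambda>w. w $ Inr False"] by simp
    then show ?thesis by (metis zmult_eq_1_iff)
  qed
  moreover have "triple (0 :: int^'n) 1 m \<noteq> 0"
    by (metis triple_simps(2) zero_index zero_neq_one)
  ultimately show ?thesis unfolding primitive_def by blast
qed

lemma primitive_triple_fe: "primitive (triple (f + k *s e) 0 0)"
proof -
  have 1: "bil G e (f + k *s e) = 1" by (simp add: bil_linear ee ef)
  have "c = 1 \<or> c = -1" if "triple (f + k *s e) 0 0 = c *s v" for c v
  proof -
    have "f + k *s e = c *s base_part v"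
      using arg_cong[OF that, of base_part] by (simp only: triple_simps) (simp add: base_part_def vec_eq_iff)
    then have "1 = c * bil G e (base_part v)" using 1 by (simp add: bil_linear)
    then show ?thesis by (metis zmult_eq_1_iff)
  qed
  moreover have "triple (f + k *s e) 0 0 \<noteq> 0"
  proof
    assume "triple (f + k *s e) 0 0 = 0"
    from arg_cong[OF this, of base_part] have "f + k *s e = 0"
      by (simp only: triple_simps) (simp add: base_part_def vec_eq_iff)
    then show False using 1 by simp
  qed
  ultimately show ?thesis unfolding primitive_def by blast
qed

subsection \<open>Counting orbits\<close>

text \<open>The parameter left open by the two normal forms is read off from the norm, which is
  constant on orbits: n = m in the first case and n = 2k in the second.\<close>

lemma primitive_normal_form:
  assumes "primitive w" "bil (twice_plus_U G) w w = 2 * n"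
  shows "w \<doteq> triple 0 1 n \<or> (even n \<and> w \<doteq> triple (f + (n div 2) *s e) 0 0)"
proof -
  obtain b x y where w: "w = triple b x y" using triple_exhaust by blast
  have odd: "triple b' x' y' \<doteq> triple 0 1 n" if w': "w \<doteq> triple b' x' y'" "odd x'" for b' x' y'
  proof -
    obtain m where m: "triple b' x' y' \<doteq> triple 0 1 m"
      using primitive_odd_normal_form[OF orbit_rel_primitive[OF w'(1) assms(1)] w'(2)] by blast
    have "bil (twice_plus_U G) (triple 0 1 m) (triple 0 1 m) = 2 * n"
      using orbit_rel_bil[OF equivalent_trans[OF w'(1) m]] assms(2) by simp
    then have "m = n" by (simp add: bil_triple)
    then show ?thesis using m by simp
  qed
  show ?thesis
  proof (cases "odd x \<or> odd y")
    case True
    then have "w \<doteq> triple 0 1 n"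
    proof
      assume "odd x"
      then show ?thesis using odd[of b x y] w orbit_rel_refl by blast
    next
      assume "odd y"
      then show ?thesis using odd[of b y x] equivalent_trans orbit_swap w by blast
    qed
    then show ?thesis ..
  next
    case False
    then obtain x' y' where xy: "x = 2 * x'" "y = 2 * y'" by (meson dvdE)
    obtain k where k: "w \<doteq> triple (f + k *s e) 0 0"
      using primitive_even_normal_form[of b x' y'] assms(1) unfolding w xy by blast
    have "bil (twice_plus_U G) (triple (f + k *s e) 0 0) (triple (f + k *s e) 0 0) = 2 * n"
      using orbit_rel_bil[OF k] assms(2) by simp
    then have "n = 2 * k" by (simp add: bil_triple bil_linear ee ff ef fe)
    then show ?thesis using k by simp
  qed
qed

lemma card_orbits:
  "card ({w. primitive w \<and> bil (twice_plus_U G) w w = 2 * n} // orbit_rel (twice_plus_U G)) = (if odd n then 1 else 2)"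
proof -
  define S where "S = {w. primitive w \<and> bil (twice_plus_U G) w w = 2 * n}"
  define R where "R = orbit_rel (twice_plus_U G)"
  define w1 :: "int^('n + bool)" where "w1 = triple 0 1 n"
  define w2 where "w2 = triple (f + (n div 2) *s e) 0 0"
  have R: "equiv UNIV R" unfolding R_def by (rule equiv_orbit_rel)
  have w1: "w1 \<in> S" by (simp add: S_def w1_def primitive_triple_01 bil_triple)
  have cls: "R `` {w} = R `` {w1} \<or> (even n \<and> R `` {w} = R `` {w2})" if "w \<in> S" for w
    using primitive_normal_form[of w n] that equiv_class_eq[OF R]
    unfolding S_def w1_def w2_def R_def by blast
  have "card (S // R) = (if odd n then 1 else 2)"
  proof (cases "odd n")
    case True
    then have "S // R = {R `` {w1}}" using cls w1 unfolding quotient_def by blast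
    then show ?thesis using True by simp
  next
    case False
    then have w2: "w2 \<in> S" by (auto simp: S_def w2_def primitive_triple_fe bil_triple bil_linear ee ff ef fe)
    have "S // R = {R `` {w1}, R `` {w2}}" using cls w1 w2 unfolding quotient_def by blast
    moreover have "R `` {w1} \<noteq> R `` {w2}"
    proof
      assume "R `` {w1} = R `` {w2}"
      then have "(w2, w1) \<in> R" using R by (metis UNIV_I eq_equiv_class)
      moreover have "even_vector (twice_plus_U G) w2"
        unfolding even_vector_def w2_def
      proof
        fix v :: "int^('n + bool)"
        obtain b x y where "v = triple b x y" using triple_exhaust by blast
        then show "even (bil (twice_plus_U G) (triple (f + (n div 2) *s e) 0 0) v)" by (simp add: bil_triple)
      qed
      ultimately have "even_vector (twice_plus_U G) w1" unfolding R_def by (rule orbit_rel_even_vector)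
      then have "even (bil (twice_plus_U G) w1 (triple 0 0 1))" unfolding even_vector_def by blast
      then show False by (simp add: w1_def bil_triple)
    qed
    ultimately show ?thesis using False by simp
  qed
  then show ?thesis unfolding S_def R_def .
qed

end

text \<open>The least positive value d of the pairing with x divides all its values, so e = x/d lies
  in the lattice and has pairing 1 with some t. Evenness allows subtracting half the norm of t times
  e, which makes t isotropic.\<close>

lemma ex_hyperbolic_pair:
  assumes sym: "symmetric_gram G" and even: "even_lattice G"
    and coordinate: "\<And>i. \<exists>g. \<forall>x. bil G x g = x $ i"
    and x: "x \<noteq> 0" "bil G x x = 0"
  shows "\<exists>e f. hyperbolic_pair G e f"
proof -
  obtain i where "x $ i \<noteq> 0" using x(1) by (auto simp: vec_eq_iff)
  then obtain g where "bil G x g \<noteq> 0" using coordinate[of i] by metis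
  then have "bil G x g > 0 \<or> bil G x (- g) > 0" by (auto simp: bil_linear)
  then have "\<exists>d t. bil G x t = int d \<and> d > 0" by (metis zero_less_imp_eq_int)
  define d where "d = (LEAST d. \<exists>t. bil G x t = int d \<and> d > 0)"
  have "\<exists>t. bil G x t = int d \<and> d > 0" unfolding d_def by (rule LeastI_ex) fact
  then obtain t where t: "bil G x t = int d" "d > 0" by blast
  have least: "d \<le> d'" if "bil G x t' = int d'" "d' > 0" for d' t'
    unfolding d_def using that by (intro Least_le) blast
  have dv: "int d dvd bil G x s" for s
  proof (rule ccontr)
    define r where "r = bil G x s mod int d"
    assume "\<not> int d dvd bil G x s"
    then have "r \<noteq> 0" unfolding r_def by (simp add: dvd_eq_mod_eq_0)
    moreover have r: "0 \<le> r" "r < int d" using t(2) by (simp_all add: r_def)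
    moreover have "bil G x (s - (bil G x s div int d) *s t) = r"
      unfolding r_def bil_diff_right bil_scale_right t(1) by (rule minus_div_mult_eq_mod)
    ultimately have "d \<le> nat r" by (intro least) auto
    then show False using r by linarith
  qed
  have "\<exists>c. x $ i = int d * c" for i using coordinate[of i] dv by (metis dvdE)
  then obtain c where "\<And>i. x $ i = int d * c i" by metis
  then have xe: "x = int d *s (\<chi> i. c i)" by (simp add: vec_eq_iff)
  define e where "e = (\<chi> i. c i)"
  have ee: "bil G e e = 0" using x(2) t(2) unfolding xe e_def[symmetric] by (simp add: bil_linear)
  have et: "bil G e t = 1" using t unfolding xe e_def[symmetric] by (simp add: bil_linear)
  obtain q where q: "bil G t t = 2 * q" using even unfolding even_lattice_def by blast
  have te: "bil G t e = 1" using et bil_sym[OF sym] by metis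
  have "hyperbolic_pair G e (t - q *s e)"
    by (rule hyperbolic_pair.intro[OF sym even coordinate ee]) (simp_all add: bil_linear ee et te q)
  then show ?thesis by blast
qed

theorem theorem1:
  fixes G :: "int^'n^'n" and n :: int
  assumes "symmetric_gram G" and "even_lattice G" and "unimodular G" and "indefinite G"
  shows "card ({w. primitive w \<and> bil (twice_plus_U G) w w = 2 * n} // orbit_rel (twice_plus_U G))
           = (if odd n then 1 else 2)"
proof -
  obtain x where "x \<noteq> 0" "bil G x x = 0"
    using indefinite_unimodular_isotropic[OF assms(1,3,4)] by blast
  then obtain e f where "hyperbolic_pair G e f"
    using ex_hyperbolic_pair[OF assms(1,2) unimodular_coordinate[OF assms(3)]] by blast
  then show ?thesis by (rule hyperbolic_pair.card_orbits)
qed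

end
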